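(* Let $d \in \mathbb{N} \cup \{\infty\}$, let $\gamma \in (0,\infty)$, let $K(z,w) = (1-\langle z,w\rangle)^{-\gamma}$ be the reproducing kernel of $\mathcal{H}_\gamma$ on $\mathbb{B}_d$, and let $\phi: \mathbb{B}_d \to \mathbb{B}_d$ and $\delta: \mathbb{B}_d \to \mathbb{C}$ be arbitrary maps. The following are equivalent: (i) $W_{\delta,\phi}$ is a unitary on $\mathcal{H}_\gamma$; (ii) $\phi \in \operatorname{Aut}(\mathbb{B}_d)$ and $\delta(z) = \mu \dfrac{K(z,a)}{K(a,a)^{1/2}}$ for all $z \in \mathbb{B}_d$, where $a = \phi^{-1}(0)$ and $\mu \in \mathbb{C}$ is some constant with $|\mu| = 1$.
   Context: For $d \in \mathbb{N}$, $\mathbb{B}_d$ is the Euclidean open unit ball of $\mathbb{C}^d$; for $d = \infty$, $\mathbb{C}^\infty$ is understood as $\ell^2$ and $\mathbb{B}_\infty$ is its open unit ball. Inner products are linear in the first variable. $\mathcal{H}_\gamma$ is the reproducing kernel Hilbert space of functions on $\mathbb{B}_d$ with kernel $K(z,w) = (1-\langle z,w\rangle)^{-\gamma}$ (principal branch). The weighted composition operator $W_{\delta,\phi}$ is $f \mapsto \delta\cdot(f\circ\phi)$. Saying that it is unitary on $\mathcal{H}_\gamma$ includes the assertion that it is well defined, i.e. maps $\mathcal{H}_\gamma$ into itself. For Hilbert spaces $\mathcal{E},\mathcal{F}$ and $U \subset \mathcal{E}$ open, $f: U \to \mathcal{F}$ is holomorphic if it is locally bounded and for all $z \in U$, $\xi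 \in \mathcal{E}$, $\eta \in \mathcal{F}$, the function $\lambda \mapsto \langle f(z+\lambda\xi),\eta\rangle$ is holomorphic in a neighborhood of $0 \in \mathbb{C}$. $\operatorname{Aut}(\mathbb{B}_d)$ is the group of bijective holomorphic maps $\mathbb{B}_d \to \mathbb{B}_d$ with holomorphic inverse. *)

theory Defs
  imports "HOL-Analysis.Analysis" "HOL-Library.Extended_Nat"
begin

text \<open>
  The vector spaces needed here, \<open>\<complex>\<^sup>d\<close> (including \<open>d = \<infinity>\<close>) and \<open>\<H>\<^sub>\<gamma>\<close>, are spaces of
  complex-valued functions, so a complex Hilbert space is given by a carrier \<open>V\<close> of functions
  \<open>'a \<Rightarrow> complex\<close> with pointwise operations and an inner product \<open>ip\<close>, linear in its first
  argument. Nothing is required of \<open>ip\<close> outside \<open>V\<close>.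
\<close>

definition ip_norm :: "(('a \<Rightarrow> complex) \<Rightarrow> ('a \<Rightarrow> complex) \<Rightarrow> complex) \<Rightarrow> ('a \<Rightarrow> complex) \<Rightarrow> real" where
  "ip_norm ip f = sqrt (Re (ip f f))"

locale complex_hilbert_space =
  fixes V :: "('a \<Rightarrow> complex) set"
    and ip :: "('a \<Rightarrow> complex) \<Rightarrow> ('a \<Rightarrow> complex) \<Rightarrow> complex"
  assumes zero_mem: "(\<lambda>x. 0) \<in> V"
    and add_mem: "f \<in> V \<Longrightarrow> g \<in> V \<Longrightarrow> (\<lambda>x. f x + g x) \<in> V"
    and scale_mem: "f \<in> V \<Longrightarrow> (\<lambda>x. c * f x) \<in> V"
    and ip_add_left: "f \<in> V \<Longrightarrow> g \<in> V \<Longrightarrow> h \<in> V \<Longrightarrow> ip (\<lambda>x. f x + g x) h = ip f h + ip g h"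
    and ip_scale_left: "f \<in> V \<Longrightarrow> h \<in> V \<Longrightarrow> ip (\<lambda>x. c * f x) h = c * ip f h"
    and ip_cnj: "f \<in> V \<Longrightarrow> g \<in> V \<Longrightarrow> ip g f = cnj (ip f g)"
    and ip_pos: "f \<in> V \<Longrightarrow> f \<noteq> (\<lambda>x. 0) \<Longrightarrow> Re (ip f f) > 0"
    and complete:
      "(\<And>n. s n \<in> V) \<Longrightarrow>
       (\<And>e. e > 0 \<Longrightarrow> \<exists>N. \<forall>m\<ge>N. \<forall>n\<ge>N. ip_norm ip (\<lambda>x. s m x - s n x) < e) \<Longrightarrow>
       \<exists>l\<in>V. (\<lambda>n. ip_norm ip (\<lambda>x. s n x - l x)) \<longlonglongrightarrow> 0"

definition unitary_on ::
  "('a \<Rightarrow> complex) set \<Rightarrow> (('a \<Rightarrow> complex) \<Rightarrow> ('a \<Rightarrow> complex) \<Rightarrow> complex)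
    \<Rightarrow> (('a \<Rightarrow> complex) \<Rightarrow> ('a \<Rightarrow> complex)) \<Rightarrow> bool" where
  "unitary_on V ip T \<longleftrightarrow>
     T ` V = V \<and>
     (\<forall>f\<in>V. \<forall>g\<in>V. T (\<lambda>x. f x + g x) = (\<lambda>x. T f x + T g x)) \<and>
     (\<forall>c. \<forall>f\<in>V. T (\<lambda>x. c * f x) = (\<lambda>x. c * T f x)) \<and>
     (\<forall>f\<in>V. \<forall>g\<in>V. ip (T f) (T g) = ip f g)"

text \<open>
  A function on \<open>X\<close> is represented by its extension by zero to the whole type, so that
  equality of functions on \<open>X\<close> is equality of the representatives.
\<close>

definition on_set :: "'a set \<Rightarrow> ('a \<Rightarrow> complex) \<Rightarrow> 'a \<Rightarrow> complex" where
  "on_set X f = (\<lambda>x. if x \<in> X then f x else 0)"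

locale rkhs = complex_hilbert_space H ip
  for H :: "('a \<Rightarrow> complex) set"
    and ip :: "('a \<Rightarrow> complex) \<Rightarrow> ('a \<Rightarrow> complex) \<Rightarrow> complex" +
  fixes X :: "'a set"
    and K :: "'a \<Rightarrow> 'a \<Rightarrow> complex"
  assumes outside: "f \<in> H \<Longrightarrow> x \<notin> X \<Longrightarrow> f x = 0"
    and kernel_mem: "w \<in> X \<Longrightarrow> on_set X (\<lambda>z. K z w) \<in> H"
    and reproducing: "w \<in> X \<Longrightarrow> f \<in> H \<Longrightarrow> ip f (on_set X (\<lambda>z. K z w)) = f w"

definition weighted_comp ::
  "'a set \<Rightarrow> ('a \<Rightarrow> complex) \<Rightarrow> ('a \<Rightarrow> 'a) \<Rightarrow> ('a \<Rightarrow> complex) \<Rightarrow> 'a \<Rightarrow> complex" where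
  "weighted_comp X \<delta> \<phi> f = on_set X (\<lambda>z. \<delta> z * f (\<phi> z))"

text \<open>
  \<open>\<complex>\<^sup>d\<close> for \<open>d :: enat\<close>: square-summable sequences vanishing at all indices \<open>\<ge> d\<close>. For
  \<open>d = \<infinity>\<close> this is \<open>\<ell>\<^sup>2\<close>; for finite \<open>d\<close> summability is automatic.
\<close>

definition cspace :: "enat \<Rightarrow> (nat \<Rightarrow> complex) set" where
  "cspace d = {z. (\<forall>i. d \<le> enat i \<longrightarrow> z i = 0) \<and> summable (\<lambda>i. (cmod (z i))\<^sup>2)}"

definition cinner :: "(nat \<Rightarrow> complex) \<Rightarrow> (nat \<Rightarrow> complex) \<Rightarrow> complex" where
  "cinner z w = (\<Sum>i. z i * cnj (w i))"

definition unit_ball :: "enat \<Rightarrow> (nat \<Rightarrow> complex) set" where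
  "unit_ball d = {z \<in> cspace d. ip_norm cinner z < 1}"

text \<open>Complex \<open>powr\<close> is the principal branch.\<close>

definition ball_kernel :: "real \<Rightarrow> (nat \<Rightarrow> complex) \<Rightarrow> (nat \<Rightarrow> complex) \<Rightarrow> complex" where
  "ball_kernel \<gamma> z w = (1 - cinner z w) powr (- complex_of_real \<gamma>)"

text \<open>
  Holomorphy of \<open>f : U \<rightarrow> F\<close> for open \<open>U \<subseteq> E\<close>: local boundedness and weak holomorphy along
  complex lines. Analyticity on \<open>{0}\<close> means holomorphy in some disc about \<open>0\<close>, which can be
  shrunk so that only values of \<open>f\<close> on \<open>U\<close> matter.
\<close>

definition holomorphic_map ::
  "('a \<Rightarrow> complex) set \<Rightarrow> (('a \<Rightarrow> complex) \<Rightarrow> ('a \<Rightarrow> complex) \<Rightarrow> complex)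
    \<Rightarrow> ('b \<Rightarrow> complex) set \<Rightarrow> (('b \<Rightarrow> complex) \<Rightarrow> ('b \<Rightarrow> complex) \<Rightarrow> complex)
    \<Rightarrow> ('a \<Rightarrow> complex) set \<Rightarrow> (('a \<Rightarrow> complex) \<Rightarrow> ('b \<Rightarrow> complex)) \<Rightarrow> bool" where
  "holomorphic_map E ipE F ipF U f \<longleftrightarrow>
     f \<in> U \<rightarrow> F \<and>
     (\<forall>z\<in>U. \<exists>r>0. \<exists>M. \<forall>w\<in>U. ip_norm ipE (\<lambda>i. w i - z i) < r \<longrightarrow> ip_norm ipF (f w) \<le> M) \<and>
     (\<forall>z\<in>U. \<forall>\<xi>\<in>E. \<forall>\<eta>\<in>F. (\<lambda>t. ipF (f (\<lambda>i. z i + t * \<xi> i)) \<eta>) analytic_on {0})"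

definition ball_aut :: "enat \<Rightarrow> ((nat \<Rightarrow> complex) \<Rightarrow> (nat \<Rightarrow> complex)) set" where
  "ball_aut d =
     {\<phi>. bij_betw \<phi> (unit_ball d) (unit_ball d) \<and>
         holomorphic_map (cspace d) cinner (cspace d) cinner (unit_ball d) \<phi> \<and>
         holomorphic_map (cspace d) cinner (cspace d) cinner (unit_ball d) (inv_into (unit_ball d) \<phi>)}"

end

theory Submission
  imports Defs "HOL-Complex_Analysis.Complex_Analysis"
begin

text \<open>
  If the weighted composition operator is unitary, its adjoint sends the kernel function at \<open>w\<close> to a
  multiple of the one at \<open>\<phi> w\<close>, so \<open>K(z,w) = \<delta>(z) cnj(\<delta>(w)) K(\<phi> z, \<phi> w)\<close>. With \<open>b = \<phi> 0\<close> and \<open>\<theta>\<close>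
  the Moebius involution exchanging \<open>b\<close> and \<open>0\<close>, the weights drop out for \<open>f = \<theta> \<circ> \<phi>\<close>, which then
  preserves \<open>K\<close> and hence the inner product. For \<open>p\<close> in the ball the operator maps the kernel
  function at \<open>p\<close> to a multiple of the one at \<open>w = f\<^sup>*(\<theta> p)\<close>; injectivity of the operator forces
  \<open>p = \<phi> w\<close>, so \<open>\<phi>\<close> is onto. Thus \<open>f\<close> is a surjective isometry and \<open>\<phi> = \<theta> \<circ> f\<close> an automorphism.

  Conversely, an automorphism composed with a Moebius map fixes \<open>0\<close>; by the Schwarz lemma and
  Liouville's theorem it preserves inner products, which gives the kernel identity. The operator is
  then isometric on the span of the kernel functions and extends by density and completeness.
\<close>

section \<open>Inner product spaces of functions\<close>

text \<open>Nothing is assumed about the regularity of \<phi> and \<delta>, so holomorphy has to be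
  extracted from identities between inner products. The delicate case is infinite dimension. The
  kernel identity only says that the operator times its adjoint fixes every kernel function, and the
  unilateral shift on l^2 with constant weight 1 satisfies it without being onto; hence surjectivity
  of \<phi> needs the isometry of the operator once more. A second obstacle is the exponent: for
  \<open>\<gamma> > 2\<close> the principal power is not injective on the values
  \<open>1 - ip z w\<close>, so equality of kernels does not give equality of inner products point
  by point. In the converse direction holomorphy is available only weakly and along complex lines,
  so Cartan's linearity argument is carried out with functions of one variable instead of
  derivatives or power series. The axioms below are those shared by the domain and by the space of
  functions, so the same lemmas serve both.\<close>

locale ip_space =
  fixes V :: "('a \<Rightarrow> complex) set"
    and ip :: "('a \<Rightarrow> complex) \<Rightarrow> ('a \<Rightarrow> complex) \<Rightarrow> complex"
  assumes zero_V [simp]: "(\<lambda>x. 0) \<in> V"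
    and add_V [simp]: "f \<in> V \<Longrightarrow> g \<in> V \<Longrightarrow> (\<lambda>x. f x + g x) \<in> V"
    and scale_V [simp]: "f \<in> V \<Longrightarrow> (\<lambda>x. c * f x) \<in> V"
    and add_left [simp]: "f \<in> V \<Longrightarrow> g \<in> V \<Longrightarrow> h \<in> V \<Longrightarrow> ip (\<lambda>x. f x + g x) h = ip f h + ip g h"
    and scale_left [simp]: "f \<in> V \<Longrightarrow> h \<in> V \<Longrightarrow> ip (\<lambda>x. c * f x) h = c * ip f h"
    and commute: "f \<in> V \<Longrightarrow> g \<in> V \<Longrightarrow> ip g f = cnj (ip f g)"
    and pos: "f \<in> V \<Longrightarrow> f \<noteq> (\<lambda>x. 0) \<Longrightarrow> Re (ip f f) > 0"

sublocale complex_hilbert_space \<subseteq> ip_space V ip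
  by unfold_locales
    (fact zero_mem add_mem scale_mem ip_add_left ip_scale_left ip_cnj ip_pos)+

context ip_space
begin

abbreviation N where "N \<equiv> ip_norm ip"

lemma diff_V [simp]:
  assumes "f \<in> V" "g \<in> V" shows "(\<lambda>x. f x - g x) \<in> V"
  using add_V [OF assms(1) scale_V [OF assms(2), of "-1"]] by simp

lemma diff_left [simp]:
  assumes "f \<in> V" "g \<in> V" "h \<in> V"
  shows "ip (\<lambda>x. f x - g x) h = ip f h - ip g h"
  using add_left [OF assms(1) scale_V [OF assms(2), of "-1"] assms(3)]
    scale_left [OF assms(2,3), of "-1"] by simp

lemma zero_left [simp]: "h \<in> V \<Longrightarrow> ip (\<lambda>x. 0) h = 0"
  using scale_left [of h h 0] by simp

lemma zero_right [simp]: "h \<in> V \<Longrightarrow> ip h (\<lambda>x. 0) = 0"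
  using commute [of "\<lambda>x. 0" h] by simp

lemma add_right [simp]:
  assumes "f \<in> V" "g \<in> V" "h \<in> V"
  shows "ip h (\<lambda>x. f x + g x) = ip h f + ip h g"
  using assms by (simp add: commute [of _ h])

lemma diff_right [simp]:
  assumes "f \<in> V" "g \<in> V" "h \<in> V"
  shows "ip h (\<lambda>x. f x - g x) = ip h f - ip h g"
  using assms by (simp add: commute [of _ h])

lemma scale_right [simp]:
  assumes "f \<in> V" "h \<in> V"
  shows "ip h (\<lambda>x. c * f x) = cnj c * ip h f"
  using assms by (simp add: commute [of _ h])

lemma ip_self_nonneg: "f \<in> V \<Longrightarrow> Re (ip f f) \<ge> 0"
  using pos [of f] by (cases "f = (\<lambda>x. 0)") auto

lemma N_ge_0 [simp]: "f \<in> V \<Longrightarrow> N f \<ge> 0"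
  by (simp add: ip_norm_def ip_self_nonneg)

lemma N_zero [simp]: "N (\<lambda>x. 0) = 0"
  by (simp add: ip_norm_def)

lemma N_square: "f \<in> V \<Longrightarrow> (N f)\<^sup>2 = Re (ip f f)"
  by (simp add: ip_norm_def ip_self_nonneg)

lemma ip_self:
  assumes "f \<in> V" shows "ip f f = complex_of_real ((N f)\<^sup>2)"
proof -
  have "Im (ip f f) = 0"
    using commute [OF assms assms] by (simp add: complex_eq_iff)
  then show ?thesis
    by (simp add: complex_eq_iff N_square assms)
qed

lemma N_eq_0: "f \<in> V \<Longrightarrow> N f = 0 \<longleftrightarrow> f = (\<lambda>x. 0)"
  using pos [of f] by (cases "f = (\<lambda>x. 0)") (auto simp: ip_norm_def)

lemma N_scale [simp]:
  assumes "f \<in> V" shows "N (\<lambda>x. c * f x) = cmod c * N f"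
proof -
  have "(N (\<lambda>x. c * f x))\<^sup>2 = Re (c * cnj c * ip f f)"
    using assms by (simp add: N_square mult_ac)
  also have "c * cnj c * ip f f = complex_of_real ((cmod c)\<^sup>2 * (N f)\<^sup>2)"
    by (simp only: complex_norm_square [symmetric] ip_self [OF assms] of_real_mult)
  finally have "(N (\<lambda>x. c * f x))\<^sup>2 = (cmod c * N f)\<^sup>2"
    by (simp add: power_mult_distrib)
  then show ?thesis
    using assms by (simp add: power2_eq_iff_nonneg)
qed

lemma N_sq_add:
  assumes "f \<in> V" "g \<in> V"
  shows "(N (\<lambda>x. f x + g x))\<^sup>2 = (N f)\<^sup>2 + (N g)\<^sup>2 + 2 * Re (ip f g)"
  using assms by (simp add: N_square commute [of f g])

lemma N_sq_diff:
  assumes "f \<in> V" "g \<in> V"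
  shows "(N (\<lambda>x. f x - g x))\<^sup>2 = (N f)\<^sup>2 + (N g)\<^sup>2 - 2 * Re (ip f g)"
  using assms by (simp add: N_square commute [of f g])

text \<open>The inequality bounds the expanded square of \<open>N (\<lambda>x. f x - g x)\<close> by
  0. In this shape vectors can be identified from norms and inner products alone, which is all that
  an isometry provides.\<close>

lemma eq_if_N_diff:
  assumes "f \<in> V" "g \<in> V" "(N f)\<^sup>2 + (N g)\<^sup>2 \<le> 2 * Re (ip f g)"
  shows "f = g"
proof -
  have "(N (\<lambda>x. f x - g x))\<^sup>2 \<le> 0"
    using assms by (simp add: N_sq_diff)
  then have "N (\<lambda>x. f x - g x) = 0" by simp
  then have "(\<lambda>x. f x - g x) = (\<lambda>x. 0)"
    using assms by (subst (asm) N_eq_0) auto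
  then show ?thesis by (auto simp: fun_eq_iff)
qed

lemma eq_if_ip_eq:
  assumes "f \<in> V" "g \<in> V" "\<And>h. h \<in> V \<Longrightarrow> ip h f = ip h g"
  shows "f = g"
proof (rule eq_if_N_diff [OF assms(1,2)])
  show "(N f)\<^sup>2 + (N g)\<^sup>2 \<le> 2 * Re (ip f g)"
    using arg_cong [OF assms(3) [OF assms(1)], of Re] arg_cong [OF assms(3) [OF assms(2)], of Re]
      arg_cong [OF commute [OF assms(1,2)], of Re] assms(1,2)
    by (simp add: N_square)
qed

lemma Cauchy_Schwarz:
  assumes "f \<in> V" "g \<in> V" shows "cmod (ip f g) \<le> N f * N g"
proof (cases "N g = 0")
  case True
  then have "g = (\<lambda>x. 0)" using N_eq_0 [OF assms(2)] by simp
  then show ?thesis using assms by simp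
next
  case False
  define c where "c = ip f g"
  define n where "n = (N g)\<^sup>2"
  have n: "n > 0" using False by (simp add: n_def)
  have gf: "ip g f = cnj c" using commute [OF assms] by (simp add: c_def)
  \<comment> \<open>\<open>?h\<close> is \<open>n\<close> times the component of \<open>f\<close>
    orthogonal to \<open>g\<close>; the factor \<open>n\<close> clears the denominator of the
    projection.\<close>
  let ?h = "\<lambda>x. of_real n * f x - c * g x"
  have V: "(\<lambda>x. of_real n * f x) \<in> V" "(\<lambda>x. c * g x) \<in> V" "?h \<in> V"
    using assms by auto
  have alg: "x * (x * y) - x * k - x * k + k * x = x * (x * y - k)" for x y k :: complex
    by (simp add: algebra_simps)
  have cc: "c * cnj c = of_real ((cmod c)\<^sup>2)"
    by (rule complex_norm_square [symmetric])
  have gg: "ip g g = of_real n" and ff: "ip f f = of_real ((N f)\<^sup>2)"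
    using assms by (auto simp only: ip_self n_def)
  have "ip ?h ?h = of_real n * (of_real n * ip f f) - of_real n * (c * cnj c) - of_real n * (c * cnj c)
      + (c * cnj c) * ip g g"
    unfolding diff_left [OF V(1,2,3)] diff_right [OF V(1,2,1)] diff_right [OF V(1,2,2)]
      scale_left [OF assms(1) V(1)] scale_left [OF assms(1) V(2)] scale_left [OF assms(2) V(1)]
      scale_left [OF assms(2) V(2)] scale_right [OF assms(1) assms(1)] scale_right [OF assms(1) assms(2)]
      scale_right [OF assms(2) assms(1)] scale_right [OF assms(2) assms(2)] gf c_def [symmetric]
    by (simp only: complex_cnj_complex_of_real) (simp add: algebra_simps)
  also have "\<dots> = of_real (n * (n * (N f)\<^sup>2 - (cmod c)\<^sup>2))"
    unfolding cc gg ff of_real_mult of_real_diff by (rule alg)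
  finally have "n * (n * (N f)\<^sup>2 - (cmod c)\<^sup>2) \<ge> 0"
    using ip_self_nonneg [OF V(3)] by (simp only: Re_complex_of_real)
  then have "(cmod c)\<^sup>2 \<le> (N g)\<^sup>2 * (N f)\<^sup>2"
    using n by (simp add: zero_le_mult_iff n_def)
  then have "(cmod c)\<^sup>2 \<le> (N f * N g)\<^sup>2"
    by (simp add: power_mult_distrib mult.commute)
  moreover have "0 \<le> N f * N g"
    using assms by simp
  ultimately show ?thesis
    unfolding c_def by (rule power2_le_imp_le)
qed

lemma N_triangle:
  assumes "f \<in> V" "g \<in> V" shows "N (\<lambda>x. f x + g x) \<le> N f + N g"
proof (rule power2_le_imp_le)
  have "Re (ip f g) \<le> N f * N g"
    by (rule order_trans [OF complex_Re_le_cmod Cauchy_Schwarz [OF assms]])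
  then show "(N (\<lambda>x. f x + g x))\<^sup>2 \<le> (N f + N g)\<^sup>2"
    using assms by (simp add: N_sq_add power2_sum)
qed (use assms in auto)

lemma N_commute:
  assumes "f \<in> V" "g \<in> V" shows "N (\<lambda>x. f x - g x) = N (\<lambda>x. g x - f x)"
  using N_scale [of "\<lambda>x. g x - f x" "-1"] assms by simp

lemma N_triangle3:
  assumes "f \<in> V" "g \<in> V" "h \<in> V"
  shows "N (\<lambda>x. f x - h x) \<le> N (\<lambda>x. f x - g x) + N (\<lambda>x. g x - h x)"
  using N_triangle [OF diff_V [OF assms(1,2)] diff_V [OF assms(2,3)]] by simp

lemma tendsto_ip_left:
  assumes "\<And>n. s n \<in> V" "l \<in> V" "g \<in> V" "(\<lambda>n. N (\<lambda>x. s n x - l x)) \<longlonglongrightarrow> 0"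
  shows "(\<lambda>n. ip (s n) g) \<longlonglongrightarrow> ip l g"
proof -
  have "(\<lambda>n. N (\<lambda>x. s n x - l x) * N g) \<longlonglongrightarrow> 0"
    by (rule tendsto_mult_left_zero [OF assms(4)])
  then have "(\<lambda>n. ip (s n) g - ip l g) \<longlonglongrightarrow> 0"
  proof (rule Lim_null_comparison [rotated])
    show "\<forall>\<^sub>F n in sequentially. cmod (ip (s n) g - ip l g) \<le> N (\<lambda>x. s n x - l x) * N g"
      using Cauchy_Schwarz [OF diff_V [OF assms(1,2)] assms(3)]
      by (simp add: diff_left [OF assms(1,2,3)])
  qed
  then show ?thesis by (rule LIM_zero_cancel)
qed

section \<open>The open unit ball\<close>

definition B where "B = {z \<in> V. N z < 1}"

lemma zero_B [simp]: "(\<lambda>x. 0) \<in> B"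
  and BI: "z \<in> V \<Longrightarrow> N z < 1 \<Longrightarrow> z \<in> B"
  and B_V [simp]: "z \<in> B \<Longrightarrow> z \<in> V"
  and B_N [simp]: "z \<in> B \<Longrightarrow> N z < 1"
  by (simp_all add: B_def)

lemma ip_B:
  assumes "z \<in> B" "w \<in> B" shows "cmod (ip z w) < 1"
proof -
  have "cmod (ip z w) \<le> N z * N w" using assms by (intro Cauchy_Schwarz) auto
  also have "\<dots> < 1"
    using mult_strict_mono' [OF B_N [OF assms(1)] B_N [OF assms(2)]] assms by simp
  finally show ?thesis .
qed

text \<open>Keeps the base of the kernel off the branch cut of \<open>Ln\<close>, with argument
  strictly between -pi/2 and pi/2.\<close>

lemma Re_1_ip_B: "z \<in> B \<Longrightarrow> w \<in> B \<Longrightarrow> Re (1 - ip z w) > 0"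
  using ip_B [of z w] complex_Re_le_cmod [of "ip z w"] by simp

lemma ip_B_neq_1 [simp]: "z \<in> B \<Longrightarrow> w \<in> B \<Longrightarrow> 1 - ip z w \<noteq> 0"
  by (metis Re_1_ip_B less_irrefl zero_complex.sel(1))

text \<open>Allows maps that agree only on \<open>B\<close> to be exchanged inside statements of the
  form \<open>analytic_on {0}\<close>.\<close>

lemma eventually_line_B:
  assumes "z \<in> B" "\<xi> \<in> V"
  shows "\<forall>\<^sub>F t in nhds 0. (\<lambda>i. z i + t * \<xi> i) \<in> B"
proof -
  have "((\<lambda>t. N z + cmod t * N \<xi>) \<longlongrightarrow> N z + cmod 0 * N \<xi>) (nhds 0)"
    by (intro tendsto_intros filterlim_ident)
  then have "\<forall>\<^sub>F t in nhds 0. N z + cmod t * N \<xi> < 1"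
    by (rule order_tendstoD) (use assms in simp)
  then show ?thesis
  proof eventually_elim
    case (elim t)
    show ?case
    proof (rule BI)
      show "N (\<lambda>i. z i + t * \<xi> i) < 1"
        using N_triangle [of z "\<lambda>i. t * \<xi> i"] assms elim by simp
    qed (use assms in auto)
  qed
qed

lemma scale_B:
  assumes "z \<in> B" "cmod c \<le> 1" shows "(\<lambda>i. c * z i) \<in> B"
proof (rule BI)
  show "N (\<lambda>i. c * z i) < 1"
    using assms mult_right_mono [of "cmod c" 1 "N z"] B_N [OF assms(1)]
    by (simp del: B_N)
qed (use assms in auto)

lemma scale_to_B:
  assumes "z \<in> V" obtains R :: real where "R > 0" "(\<lambda>i. of_real (1/R) * z i) \<in> B"
proof
  show "1 + N z > 0" using N_ge_0 [OF assms] by linarith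
  then show "(\<lambda>i. of_real (1/(1 + N z)) * z i) \<in> B"
    using assms by (intro BI) (auto simp add: norm_divide simp del: of_real_divide)
qed

end

section \<open>Moebius involutions of the ball\<close>

text \<open>Scalar core of \<open>moebius_identity\<close>: \<open>p\<close>, \<open>q\<close>,
  \<open>m\<close>, \<open>s\<close> stand for \<open>ip x b\<close>, \<open>ip b y\<close>,
  \<open>ip x y\<close> and \<open>moebius_scale b\<close>, and \<open>ip b b\<close> is already
  replaced by \<open>1 - s\<^sup>2\<close>. Writing \<open>p\<close> and \<open>q\<close> as
  multiples of \<open>1 + s\<close> removes the nested fractions and leaves a polynomial
  identity.\<close>

lemma moebius_ip_algebra:
  fixes p q m s :: complex
  assumes "1 - p \<noteq> 0" "1 - q \<noteq> 0" "1 + s \<noteq> 0"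
  shows "1 - ((1 - p/(1+s))/(1-p) * ((1 - q/(1+s))/(1-q) * (1 - s\<^sup>2) - s/(1-q) * q)
            - s/(1-p) * ((1 - q/(1+s))/(1-q) * p - s/(1-q) * m))
         = s\<^sup>2 * (1 - m) / ((1-p)*(1-q))" (is "1 - ?L = _")
proof -
  define u v where "u = p/(1+s)" and "v = q/(1+s)"
  have p: "p = u * (1+s)" and q: "q = v * (1+s)" using assms by (simp_all add: u_def v_def)
  have L: "?L = ((1-u)*(1-v)*(1-s\<^sup>2) - (1-u) * s * q - s * (1-v) * p + s\<^sup>2 * m) / ((1-p)*(1-q))"
    unfolding u_def [symmetric] v_def [symmetric]
    using assms by (simp add: divide_simps) (simp add: algebra_simps power2_eq_square)
  have "(1-p)*(1-q) - ((1-u)*(1-v)*(1-s\<^sup>2) - (1-u) * s * q - s * (1-v) * p + s\<^sup>2 * m) = s\<^sup>2 * (1 - m)"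
    unfolding p q by (simp add: algebra_simps power2_eq_square)
  moreover have "1 - M/D = R/D" if "D - M = R" "D \<noteq> 0" for D M R :: complex
    using that by (auto simp: diff_divide_distrib)
  ultimately show ?thesis
    unfolding L using assms by simp
qed

context ip_space
begin

definition moebius_scale :: "('a \<Rightarrow> complex) \<Rightarrow> complex" where
  "moebius_scale b = complex_of_real (sqrt (1 - (N b)\<^sup>2))"

text \<open>The usual formula is \<open>(b - P x - s (x - P x)) / (1 - ip x b)\<close>, where \<open>s\<^sup>2 = 1 - |b|\<^sup>2\<close> and \<open>P\<close> is the
  projection onto the line through \<open>b\<close>. Here \<open>(1 - s) / |b|\<^sup>2\<close> is replaced by \<open>1 / (1 + s)\<close>, so that
  \<open>b = 0\<close> is not a special case.\<close>

definition moebius :: "('a \<Rightarrow> complex) \<Rightarrow> ('a \<Rightarrow> complex) \<Rightarrow> ('a \<Rightarrow> complex)" where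
  "moebius b x = (\<lambda>i. (1 - ip x b / (1 + moebius_scale b)) / (1 - ip x b) * b i - moebius_scale b / (1 - ip x b) * x i)"

lemma N_sq_less_1: "b \<in> B \<Longrightarrow> (N b)\<^sup>2 < 1"
  by (simp add: abs_square_less_1)

lemma moebius_scale_sq: "b \<in> B \<Longrightarrow> (moebius_scale b)\<^sup>2 = 1 - ip b b"
  using N_sq_less_1 [of b] by (simp add: moebius_scale_def ip_self flip: of_real_power)

lemma moebius_scale_nz:
  assumes "b \<in> B" shows "moebius_scale b \<noteq> 0" "1 + moebius_scale b \<noteq> 0"
proof -
  have pos: "sqrt (1 - (N b)\<^sup>2) > 0"
    using N_sq_less_1 [OF assms] by simp
  then show "moebius_scale b \<noteq> 0" by (simp add: moebius_scale_def)
  have "1 + moebius_scale b = complex_of_real (1 + sqrt (1 - (N b)\<^sup>2))" by (simp add: moebius_scale_def)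
  then show "1 + moebius_scale b \<noteq> 0" using pos by (simp only: of_real_eq_0_iff)
qed

lemma cnj_moebius_scale [simp]: "cnj (moebius_scale b) = moebius_scale b"
  by (simp add: moebius_scale_def)

lemma moebius_V [simp]: "b \<in> V \<Longrightarrow> x \<in> V \<Longrightarrow> moebius b x \<in> V"
  unfolding moebius_def by (intro diff_V scale_V)

lemma ip_moebius_left:
  "b \<in> V \<Longrightarrow> x \<in> V \<Longrightarrow> h \<in> V \<Longrightarrow>
    ip (moebius b x) h = (1 - ip x b / (1 + moebius_scale b)) / (1 - ip x b) * ip b h - moebius_scale b / (1 - ip x b) * ip x h"
  unfolding moebius_def by (simp only: diff_left scale_left scale_V)

text \<open>The transformation law behind everything that follows: its power with exponent
  \<open>-\<gamma>\<close> is \<open>kern_moebius\<close>, the case \<open>y = 0\<close> is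
  \<open>moebius_ip_b\<close>, and the diagonal \<open>x = y\<close> shows that the ball is
  preserved.\<close>

lemma moebius_identity:
  assumes b: "b \<in> B" and x: "x \<in> B" and y: "y \<in> B"
  shows "1 - ip (moebius b x) (moebius b y) = (1 - ip b b) * (1 - ip x y) / ((1 - ip x b) * (1 - ip b y))"
proof -
  note V = B_V [OF b] B_V [OF x] B_V [OF y]
  define s where "s = moebius_scale b"
  have cs: "cnj s = s" by (simp add: s_def)
  have r: "ip h (moebius b y) = (1 - ip b y / (1 + s)) / (1 - ip b y) * ip h b - s / (1 - ip b y) * ip h y"
    if "h \<in> V" for h
    unfolding commute [OF moebius_V [OF V(1,3)] that]
    by (simp add: ip_moebius_left V that cs commute [OF V(1) that] commute [OF V(3) that]
        commute [OF V(3) V(1)] flip: s_def)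
  have s2: "ip b b = 1 - s\<^sup>2"
    using moebius_scale_sq [OF b] by (simp add: s_def)
  have "1 - ip (moebius b x) (moebius b y) = s\<^sup>2 * (1 - ip x y) / ((1 - ip x b) * (1 - ip b y))"
    unfolding ip_moebius_left [OF V(1,2) moebius_V [OF V(1,3)]] r [OF V(1)] r [OF V(2)]
      s_def [symmetric] s2
    by (rule moebius_ip_algebra [OF ip_B_neq_1 [OF x b] ip_B_neq_1 [OF b y]
          moebius_scale_nz(2) [OF b, folded s_def]])
  then show ?thesis
    by (simp add: s2)
qed

lemma moebius_0: "b \<in> V \<Longrightarrow> moebius b (\<lambda>i. 0) = b"
  by (simp add: moebius_def)

lemma moebius_ip_b:
  assumes b: "b \<in> B" and x: "x \<in> B"
  shows "1 - ip (moebius b x) b = (1 - ip b b) / (1 - ip x b)"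
  using moebius_identity [OF b x zero_B] b x by (simp add: moebius_0)

lemma moebius_B [simp]:
  assumes b: "b \<in> B" and x: "x \<in> B" shows "moebius b x \<in> B"
proof (rule BI)
  note V = B_V [OF b] B_V [OF x]
  show m: "moebius b x \<in> V" using V by simp
  have "(1 - ip x b) * (1 - ip b x) = complex_of_real ((cmod (1 - ip x b))\<^sup>2)"
    unfolding complex_norm_square commute [OF V(2,1)] by simp
  then have "1 - complex_of_real ((N (moebius b x))\<^sup>2) =
      complex_of_real ((1 - (N b)\<^sup>2) * (1 - (N x)\<^sup>2) / (cmod (1 - ip x b))\<^sup>2)"
    using moebius_identity [OF b x x] by (simp add: ip_self V m)
  then have "complex_of_real (1 - (N (moebius b x))\<^sup>2) =
      complex_of_real ((1 - (N b)\<^sup>2) * (1 - (N x)\<^sup>2) / (cmod (1 - ip x b))\<^sup>2)"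
    by simp
  then have "1 - (N (moebius b x))\<^sup>2 = (1 - (N b)\<^sup>2) * (1 - (N x)\<^sup>2) / (cmod (1 - ip x b))\<^sup>2"
    unfolding of_real_eq_iff .
  also have "\<dots> > 0"
    using N_sq_less_1 [OF b] N_sq_less_1 [OF x] ip_B_neq_1 [OF x b] by simp
  finally have "(N (moebius b x))\<^sup>2 < 1" by simp
  then show "N (moebius b x) < 1"
    using N_ge_0 [OF m] by (simp add: power_less_one_iff abs_square_less_1)
qed

lemma moebius_moebius:
  assumes b: "b \<in> B" and x: "x \<in> B"
  shows "moebius b (moebius b x) = x"
proof -
  define s p where "s = moebius_scale b" and "p = ip x b"
  have nz: "1 - p \<noteq> 0" "s \<noteq> 0" "1 + s \<noteq> 0"
    using ip_B_neq_1 [OF x b] moebius_scale_nz [OF b] by (auto simp: s_def p_def)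
  have "1 - ip (moebius b x) b = s\<^sup>2 / (1 - p)"
    using moebius_ip_b [OF b x] moebius_scale_sq [OF b] by (simp add: s_def p_def)
  then have q: "1 - ip (moebius b x) b = s\<^sup>2 / (1 - p)" "ip (moebius b x) b = 1 - s\<^sup>2 / (1 - p)"
    by (simp_all add: algebra_simps)
  have eq: "moebius b (moebius b x) i = ((1 - (1 - s\<^sup>2/(1-p))/(1+s)) * b i - s * moebius b x i) / (s\<^sup>2/(1-p))" for i
  proof -
    have *: "a/D * y - s/D * z = (a * y - s * z)/D" for a D y z
      by (simp add: diff_divide_distrib)
    show ?thesis
      unfolding moebius_def [of b "moebius b x"] q(1) s_def [symmetric] unfolding q(2) by (rule *)
  qed
  \<comment> \<open>The coefficient of \<open>b\<close> in the numerator is \<open>s\<close> times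
    its coefficient in \<open>moebius b x\<close>, so the multiples of \<open>b\<close> cancel and
    only \<open>x\<close> survives.\<close>
  have c: "1 - (1 - s\<^sup>2/(1-p))/(1+s) = s * (1 - p/(1+s)) / (1-p)"
    using nz by (simp add: divide_simps) (simp add: algebra_simps power2_eq_square)
  have *: "(s * k / A * y - s * (k / A * y - s / A * t)) / (s\<^sup>2 / A) = t" if "A \<noteq> 0" for k A y t
    using that nz by (simp add: field_simps power2_eq_square)
  have "moebius b (moebius b x) i = x i" for i
    unfolding eq c unfolding moebius_def [of b x] s_def [symmetric] p_def [symmetric]
    by (rule * [OF nz(1)])
  then show ?thesis by auto
qed

end

section \<open>Biholomorphic maps of the ball fixing the origin\<close>

context ip_space
begin

text \<open>The weak holomorphy clause of \<open>holomorphic_map\<close>. For self-maps of the ball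
  local boundedness is automatic, so this clause alone is carried through the proof.\<close>

definition line_analytic :: "(('a \<Rightarrow> complex) \<Rightarrow> ('a \<Rightarrow> complex)) \<Rightarrow> bool" where
  "line_analytic f \<longleftrightarrow> (\<forall>z\<in>B. \<forall>\<xi>\<in>V. \<forall>\<eta>\<in>V. (\<lambda>t. ip (f (\<lambda>i. z i + t * \<xi> i)) \<eta>) analytic_on {0})"

lemma line_analytic_at:
  assumes "line_analytic f" "\<xi> \<in> V" "\<eta> \<in> V" "(\<lambda>i. z i + t0 * \<xi> i) \<in> B"
  shows "(\<lambda>t. ip (f (\<lambda>i. z i + t * \<xi> i)) \<eta>) analytic_on {t0}"
proof -
  let ?g = "\<lambda>t. ip (f (\<lambda>i. (z i + t0 * \<xi> i) + t * \<xi> i)) \<eta>"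
  have "?g analytic_on {0}"
    using assms(1) [unfolded line_analytic_def, rule_format, OF assms(4,2,3)] .
  then have "(?g \<circ> (\<lambda>t. t - t0)) analytic_on {t0}"
    by (intro analytic_on_compose analytic_intros) auto
  also have "?g \<circ> (\<lambda>t. t - t0) = (\<lambda>t. ip (f (\<lambda>i. z i + t * \<xi> i)) \<eta>)"
    by (simp add: fun_eq_iff o_def algebra_simps)
  finally show ?thesis .
qed

text \<open>Restricting to the disc spanned by a unit vector \<open>u\<close> and testing against a
  unit vector \<open>\<eta>\<close> produces a self-map of the unit disc, to which the one-variable
  Schwarz lemma applies.\<close>

lemma schwarz_line:
  assumes f: "line_analytic f" "f \<in> B \<rightarrow> B" and u: "u \<in> V" "N u = 1" and \<eta>: "\<eta> \<in> V" "N \<eta> = 1"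
  shows "(\<lambda>t. ip (f (\<lambda>i. t * u i)) \<eta>) holomorphic_on ball 0 1"
    and "cmod t < 1 \<Longrightarrow> (\<lambda>i. t * u i) \<in> B"
    and "cmod t < 1 \<Longrightarrow> cmod (ip (f (\<lambda>i. t * u i)) \<eta>) < 1"
proof -
  show B: "(\<lambda>i. t * u i) \<in> B" if "cmod t < 1" for t
    using that u by (intro BI) simp_all
  have "(\<lambda>t. ip (f (\<lambda>i. t * u i)) \<eta>) analytic_on {t0}" if "t0 \<in> ball 0 1" for t0
    using line_analytic_at [OF f(1) u(1) \<eta>(1), of "\<lambda>i. 0" t0] B [of t0] that by simp
  then show "(\<lambda>t. ip (f (\<lambda>i. t * u i)) \<eta>) holomorphic_on ball 0 1"
    using analytic_on_analytic_at analytic_imp_holomorphic by blast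
  show "cmod (ip (f (\<lambda>i. t * u i)) \<eta>) < 1" if "cmod t < 1" for t
  proof -
    have fB: "f (\<lambda>i. t * u i) \<in> B" using f(2) B [OF that] by blast
    show ?thesis
      using Cauchy_Schwarz [OF B_V [OF fB] \<eta>(1)] B_N [OF fB] \<eta>(2) by simp
  qed
qed

lemma normalize:
  assumes "z \<in> V" "N z \<noteq> 0"
  defines "u \<equiv> \<lambda>i. complex_of_real (1 / N z) * z i"
  shows "u \<in> V" "N u = 1" "(\<lambda>i. complex_of_real (N z) * u i) = z"
proof -
  show "u \<in> V" unfolding u_def using assms(1) by (rule scale_V)
  show "N u = 1" unfolding u_def N_scale [OF assms(1)] using assms(1,2) by (simp add: norm_divide)
  show "(\<lambda>i. complex_of_real (N z) * u i) = z" using assms(2) by (simp add: u_def)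
qed

text \<open>Choosing \<open>\<eta>\<close> in the direction of \<open>f z\<close> makes the test
  lossless: \<open>ip (f z) \<eta>\<close> equals \<open>N (f z)\<close>.\<close>

lemma schwarz_norm:
  assumes f: "line_analytic f" "f \<in> B \<rightarrow> B" "f (\<lambda>i. 0) = (\<lambda>i. 0)" and z: "z \<in> B"
  shows "N (f z) \<le> N z"
proof (cases "N z = 0 \<or> N (f z) = 0")
  case True
  moreover have "N z = 0 \<Longrightarrow> N (f z) = 0"
    using N_eq_0 [OF B_V [OF z]] f(3) by simp
  ultimately show ?thesis
    using N_ge_0 [OF B_V [OF z]] by auto
next
  case False
  have fz: "f z \<in> B" using f(2) z by blast
  define u \<eta> where "u = (\<lambda>i. complex_of_real (1 / N z) * z i)"
    and "\<eta> = (\<lambda>i. complex_of_real (1 / N (f z)) * f z i)"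
  have u: "u \<in> V" "N u = 1" "(\<lambda>i. complex_of_real (N z) * u i) = z"
    unfolding u_def using normalize [OF B_V [OF z]] False by simp_all
  have \<eta>: "\<eta> \<in> V" "N \<eta> = 1"
    unfolding \<eta>_def using normalize [OF B_V [OF fz]] False by simp_all
  have Nz: "cmod (of_real (N z)) = N z" using B_V [OF z] by simp
  note S = schwarz_line [OF f(1,2) u(1,2) \<eta>]
  have "cmod (ip (f (\<lambda>i. of_real (N z) * u i)) \<eta>) \<le> cmod (of_real (N z))"
  proof (rule Schwarz_Lemma(1) [OF S(1)])
    show "ip (f (\<lambda>i. 0 * u i)) \<eta> = 0" using f(3) \<eta> by simp
    show "cmod (of_real (N z)) < 1" using Nz B_N [OF z] by simp
  qed (use S(3) in auto)
  then have "cmod (ip (f z) \<eta>) \<le> N z" unfolding u(3) Nz .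
  moreover have "ip (f z) \<eta> = of_real (N (f z))"
    unfolding \<eta>_def scale_right [OF B_V [OF fz] B_V [OF fz]] ip_self [OF B_V [OF fz]]
    using False by (simp add: power2_eq_square)
  ultimately show ?thesis using B_V [OF fz] by simp
qed

text \<open>Since \<open>N (f z) = N z\<close>, the equality case of the Schwarz lemma applies on
  the disc through \<open>z\<close>. It determines only the component of
  \<open>f (\<lambda>i. c * z i)\<close> along \<open>f z\<close>; this component already has the
  full norm \<open>cmod c * N z\<close>, so nothing orthogonal to \<open>f z\<close> is
  left.\<close>

lemma schwarz_homogeneous:
  assumes f: "line_analytic f" "f \<in> B \<rightarrow> B" and iso: "\<And>z. z \<in> B \<Longrightarrow> N (f z) = N z"
    and z: "z \<in> B" and cz: "(\<lambda>i. c * z i) \<in> B"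
  shows "f (\<lambda>i. c * z i) = (\<lambda>i. c * f z i)"
proof -
  have f0: "f (\<lambda>i. 0) = (\<lambda>i. 0)"
    using iso [OF zero_B] N_eq_0 f(2) zero_B B_V by (metis N_zero Pi_mem)
  have fz: "f z \<in> B" and fcz: "f (\<lambda>i. c * z i) \<in> B" using f(2) z cz by blast+
  show ?thesis
  proof (cases "N z = 0")
    case True
    then have "z = (\<lambda>i. 0)" using N_eq_0 [OF B_V [OF z]] by simp
    then show ?thesis using f0 by simp
  next
    case False
    define u \<eta> where "u = (\<lambda>i. complex_of_real (1 / N z) * z i)"
      and "\<eta> = (\<lambda>i. complex_of_real (1 / N (f z)) * f z i)"
    have u: "u \<in> V" "N u = 1" "(\<lambda>i. complex_of_real (N z) * u i) = z"
      unfolding u_def using normalize [OF B_V [OF z]] False by simp_all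
    have \<eta>: "\<eta> \<in> V" "N \<eta> = 1"
      unfolding \<eta>_def using normalize [OF B_V [OF fz]] False iso [OF z] by simp_all
    have Nz: "cmod (of_real (N z)) = N z" using B_V [OF z] by simp
    note S = schwarz_line [OF f u(1,2) \<eta>]
    let ?g = "\<lambda>t. ip (f (\<lambda>i. t * u i)) \<eta>"
    have \<eta>ip: "ip h \<eta> = of_real (1 / N z) * ip h (f z)" if "h \<in> V" for h
      unfolding \<eta>_def scale_right [OF B_V [OF fz] that] iso [OF z] by simp
    have gNz: "?g (of_real (N z)) = of_real (N z)"
      unfolding u(3) \<eta>ip [OF B_V [OF fz]] ip_self [OF B_V [OF fz]] iso [OF z]
      using False by (simp add: power2_eq_square)
    have "\<exists>\<alpha>. (\<forall>t. cmod t < 1 \<longrightarrow> ?g t = \<alpha> * t) \<and> cmod \<alpha> = 1"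
    proof (rule Schwarz_Lemma(3) [OF S(1), of 0])
      show "ip (f (\<lambda>i. 0 * u i)) \<eta> = 0" using f0 \<eta> by simp
      show "(\<exists>t. cmod t < 1 \<and> t \<noteq> 0 \<and> cmod (?g t) = cmod t) \<or> cmod (deriv ?g 0) = 1"
        using gNz Nz B_N [OF z] False by (intro disjI1 exI [of _ "of_real (N z)"]) simp
    qed (use S(3) in auto)
    then obtain \<alpha> where \<alpha>: "\<And>t. cmod t < 1 \<Longrightarrow> ?g t = \<alpha> * t" by blast
    have "\<alpha> = 1"
      using \<alpha> [of "of_real (N z)"] Nz B_N [OF z] gNz False by simp
    have cNz: "cmod c * N z < 1" using B_N [OF cz] N_scale [OF B_V [OF z], of c] by simp
    have "?g (c * of_real (N z)) = c * of_real (N z)"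
      using \<alpha> [of "c * of_real (N z)"] cNz Nz \<open>\<alpha> = 1\<close> by (simp add: norm_mult)
    moreover have "(\<lambda>i. c * of_real (N z) * u i) = (\<lambda>i. c * z i)"
      using u(3) by (metis mult.assoc)
    ultimately have "ip (f (\<lambda>i. c * z i)) \<eta> = c * of_real (N z)" by simp
    then have *: "ip (f (\<lambda>i. c * z i)) (f z) = c * of_real ((N z)\<^sup>2)"
      unfolding \<eta>ip [OF B_V [OF fcz]] using False by (simp add: field_simps power2_eq_square)
    show ?thesis
    proof (rule eq_if_N_diff)
      have "ip (f (\<lambda>i. c * z i)) (\<lambda>i. c * f z i) = (c * cnj c) * of_real ((N z)\<^sup>2)"
        unfolding scale_right [OF B_V [OF fz] B_V [OF fcz]] * by simp
      also have "\<dots> = of_real ((cmod c)\<^sup>2 * (N z)\<^sup>2)"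
        by (simp only: complex_norm_square [symmetric] of_real_mult)
      finally have "Re (ip (f (\<lambda>i. c * z i)) (\<lambda>i. c * f z i)) = (cmod c)\<^sup>2 * (N z)\<^sup>2"
        by (simp only: Re_complex_of_real)
      then show "(N (f (\<lambda>i. c * z i)))\<^sup>2 + (N (\<lambda>i. c * f z i))\<^sup>2
          \<le> 2 * Re (ip (f (\<lambda>i. c * z i)) (\<lambda>i. c * f z i))"
        unfolding iso [OF cz] N_scale [OF B_V [OF z]] N_scale [OF B_V [OF fz]] iso [OF z]
        by (simp add: power_mult_distrib)
    qed (use fz fcz in auto)
  qed
qed

text \<open>By homogeneity any radius exceeding \<open>N x\<close> may replace \<open>1 + N x\<close>. Along complex lines the extension is entire of linear growth, hence affine by Liouville's theorem.\<close>

definition homogeneous_ext :: "(('a \<Rightarrow> complex) \<Rightarrow> ('a \<Rightarrow> complex)) \<Rightarrow> ('a \<Rightarrow> complex) \<Rightarrow> ('a \<Rightarrow> complex)" where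
  "homogeneous_ext f x = (\<lambda>i. of_real (1 + N x) * f (\<lambda>i. of_real (1 / (1 + N x)) * x i) i)"

end

locale schwarz_isometry = ip_space +
  fixes f
  assumes f: "line_analytic f" "f \<in> B \<rightarrow> B" and iso: "\<And>z. z \<in> B \<Longrightarrow> N (f z) = N z"
begin

lemma shrink_B:
  assumes "x \<in> V" "R > N x" shows "(\<lambda>i. complex_of_real (1/R) * x i) \<in> B"
proof (rule BI)
  have "R > 0" using assms N_ge_0 [OF assms(1)] by linarith
  then show "N (\<lambda>i. complex_of_real (1/R) * x i) < 1"
    unfolding N_scale [OF assms(1)] using assms(2) by (simp add: norm_divide)
qed (intro scale_V assms)

lemma homogeneous_ext_eq:
  assumes x: "x \<in> V" and R: "R > N x"
  shows "homogeneous_ext f x = (\<lambda>i. of_real R * f (\<lambda>i. of_real (1/R) * x i) i)"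
proof -
  have pos: "R > 0" "1 + N x > 0" using N_ge_0 [OF x] R by linarith+
  let ?z = "\<lambda>i. complex_of_real (1/(1 + N x)) * x i"
  have eq: "(\<lambda>i. of_real ((1 + N x)/R) * ?z i) = (\<lambda>i. of_real (1/R) * x i)"
    using pos(2) by (simp add: mult.assoc [symmetric] of_real_mult [symmetric]
        del: of_real_add of_real_divide of_real_mult)
  have "f (\<lambda>i. of_real (1/R) * x i) = (\<lambda>i. of_real ((1 + N x)/R) * f ?z i)"
    unfolding eq [symmetric]
  proof (rule schwarz_homogeneous [OF f iso])
    show "?z \<in> B" by (rule shrink_B [OF x]) simp
    show "(\<lambda>i. of_real ((1 + N x)/R) * ?z i) \<in> B" unfolding eq by (rule shrink_B [OF x R])
  qed
  then show ?thesis
    using pos(1) by (simp add: homogeneous_ext_def fun_eq_iff del: of_real_add)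
qed

lemma homogeneous_ext_B: "z \<in> B \<Longrightarrow> homogeneous_ext f z = f z"
  using homogeneous_ext_eq [of z 1] by simp

lemma homogeneous_ext_V [simp]:
  assumes "x \<in> V" shows "homogeneous_ext f x \<in> V"
proof -
  have "f (\<lambda>i. of_real (1 / (1 + N x)) * x i) \<in> B"
    using shrink_B [OF assms, of "1 + N x"] f(2) by auto
  then show ?thesis unfolding homogeneous_ext_def by (intro scale_V B_V)
qed

lemma N_homogeneous_ext [simp]:
  assumes x: "x \<in> V" shows "N (homogeneous_ext f x) = N x"
proof -
  have B: "(\<lambda>i. of_real (1 / (1 + N x)) * x i) \<in> B"
    using shrink_B [OF assms, of "1 + N x"] by auto
  then have "f (\<lambda>i. of_real (1 / (1 + N x)) * x i) \<in> V"
    by (intro B_V funcset_mem [OF f(2)])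
  moreover have "1 + N x > 0" using N_ge_0 [OF x] by linarith
  ultimately show ?thesis
    unfolding homogeneous_ext_def by (simp add: iso [OF B] x norm_divide del: of_real_add of_real_divide)
qed

lemma homogeneous_ext_scale:
  assumes x: "x \<in> V" shows "homogeneous_ext f (\<lambda>i. c * x i) = (\<lambda>i. c * homogeneous_ext f x i)"
proof -
  define R where "R = 1 + N x + cmod c * N x"
  have R: "R > N x" "R > N (\<lambda>i. c * x i)"
    using N_ge_0 [OF x] unfolding N_scale [OF x] R_def by (auto simp: add_pos_nonneg)
  let ?z = "\<lambda>i. complex_of_real (1/R) * x i"
  have eq: "(\<lambda>i. complex_of_real (1/R) * (c * x i)) = (\<lambda>i. c * ?z i)"
    by (simp add: mult_ac)
  have "f (\<lambda>i. c * ?z i) = (\<lambda>i. c * f ?z i)"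
    using shrink_B [OF x R(1)] shrink_B [OF scale_V [OF x] R(2)]
    unfolding eq by (intro schwarz_homogeneous [OF f iso])
  then show ?thesis
    unfolding homogeneous_ext_eq [OF x R(1)] homogeneous_ext_eq [OF scale_V [OF x] R(2)] eq by (simp add: mult_ac)
qed

lemma homogeneous_ext_affine:
  assumes x: "x \<in> V" and \<xi>: "\<xi> \<in> V" and \<eta>: "\<eta> \<in> V"
  obtains A C where "\<And>t. ip (homogeneous_ext f (\<lambda>i. x i + t * \<xi> i)) \<eta> = A + C * t"
proof -
  define h where "h t = ip (homogeneous_ext f (\<lambda>i. x i + t * \<xi> i)) \<eta>" for t
  have V: "(\<lambda>i. x i + t * \<xi> i) \<in> V" for t using x \<xi> by simp
  have Nt: "N (\<lambda>i. x i + t * \<xi> i) \<le> N x + cmod t * N \<xi>" for t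
    using N_triangle [OF x scale_V [OF \<xi>]] by (simp add: \<xi>)
  have "h analytic_on {t0}" for t0
  proof -
    \<comment> \<open>One radius serves all \<open>t\<close> in the unit disc about
      \<open>t0\<close>. There the extension is a fixed rescaling of \<open>f\<close>, so
      analyticity carries over from \<open>f\<close>.\<close>
    define R where "R = 1 + N x + (cmod t0 + 1) * N \<xi>"
    have R: "R > N (\<lambda>i. x i + t * \<xi> i)" if "dist t t0 < 1" for t
    proof -
      have "cmod t \<le> cmod t0 + 1"
        using that norm_triangle_ineq2 [of t t0] by (simp add: dist_norm)
      then have "cmod t * N \<xi> \<le> (cmod t0 + 1) * N \<xi>"
        using \<xi> by (simp add: mult_right_mono)
      then show ?thesis using Nt [of t] by (simp add: R_def)
    qed
    let ?x = "\<lambda>i. complex_of_real (1/R) * x i" and ?\<xi> = "\<lambda>i. complex_of_real (1/R) * \<xi> i"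
    have eq: "(\<lambda>i. complex_of_real (1/R) * (x i + t * \<xi> i)) = (\<lambda>i. ?x i + t * ?\<xi> i)" for t
      by (simp add: fun_eq_iff algebra_simps)
    have B: "(\<lambda>i. ?x i + t * ?\<xi> i) \<in> B" if "dist t t0 < 1" for t
      using shrink_B [OF V R [OF that]] unfolding eq .
    have "(\<lambda>t. ip (f (\<lambda>i. ?x i + t * ?\<xi> i)) \<eta>) analytic_on {t0}"
      by (intro line_analytic_at f(1) scale_V \<xi> \<eta> B) simp
    then have an: "(\<lambda>t. of_real R * ip (f (\<lambda>i. ?x i + t * ?\<xi> i)) \<eta>) analytic_on {t0}"
      by (intro analytic_intros)
    have "h t = of_real R * ip (f (\<lambda>i. ?x i + t * ?\<xi> i)) \<eta>" if "dist t t0 < 1" for t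
    proof -
      have "f (\<lambda>i. ?x i + t * ?\<xi> i) \<in> V" by (intro B_V funcset_mem [OF f(2)] B that)
      then show ?thesis
        unfolding h_def homogeneous_ext_eq [OF V R [OF that]] eq using \<eta> by (rule scale_left)
    qed
    then have "\<forall>\<^sub>F t in nhds t0. h t = of_real R * ip (f (\<lambda>i. ?x i + t * ?\<xi> i)) \<eta>"
      unfolding eventually_nhds_metric by (intro exI [of _ 1]) auto
    then show ?thesis
      by (subst analytic_at_cong [OF _ refl]) (use an in auto)
  qed
  then have hol: "h holomorphic_on UNIV"
    using analytic_on_analytic_at analytic_imp_holomorphic by blast
  have bound: "cmod (h t) \<le> (N x + N \<xi>) * N \<eta> * cmod t ^ 1" if "1 \<le> cmod t" for t
  proof -
    have "cmod (h t) \<le> N (\<lambda>i. x i + t * \<xi> i) * N \<eta>"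
      unfolding h_def using Cauchy_Schwarz [OF homogeneous_ext_V [OF V] \<eta>] N_homogeneous_ext [OF V] by simp
    also have "\<dots> \<le> (N x + cmod t * N \<xi>) * N \<eta>"
      using Nt N_ge_0 [OF \<eta>] by (rule mult_right_mono)
    also have "\<dots> \<le> (cmod t * N x + cmod t * N \<xi>) * N \<eta>"
      using N_ge_0 [OF \<eta>] N_ge_0 [OF x] mult_right_mono [OF that N_ge_0 [OF x]]
      by (intro mult_right_mono) auto
    finally show ?thesis by (simp add: algebra_simps)
  qed
  have "h t = h 0 + deriv h 0 * t" for t
    using Liouville_polynomial [OF hol bound, where \<xi> = t] by simp
  then show ?thesis using that unfolding h_def by blast
qed

text \<open>Affinity along a line leaves the slope unknown; \<open>C\<close> has to be recognised as
  the value at \<open>y\<close>. The lines \<open>x + t y\<close> and \<open>y + t x\<close> share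
  the point \<open>x + y\<close>, and homogeneity links \<open>y + 2 x\<close> to
  \<open>x + y/2\<close>. The two resulting linear equations give \<open>C' = A\<close> and
  \<open>A' = C\<close>.\<close>

lemma homogeneous_ext_add:
  assumes x: "x \<in> V" and y: "y \<in> V"
  shows "homogeneous_ext f (\<lambda>i. x i + y i) = (\<lambda>i. homogeneous_ext f x i + homogeneous_ext f y i)"
proof (rule eq_if_ip_eq)
  fix \<eta> assume \<eta>: "\<eta> \<in> V"
  obtain A C where A: "\<And>t. ip (homogeneous_ext f (\<lambda>i. x i + t * y i)) \<eta> = A + C * t"
    by (rule homogeneous_ext_affine [OF x y \<eta>]) blast
  obtain A' C' where A': "\<And>t. ip (homogeneous_ext f (\<lambda>i. y i + t * x i)) \<eta> = A' + C' * t"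
    by (rule homogeneous_ext_affine [OF y x \<eta>]) blast
  have "(\<lambda>i. y i + 2 * x i) = (\<lambda>i. 2 * (x i + (1/2) * y i))"
    by (simp add: fun_eq_iff)
  then have "homogeneous_ext f (\<lambda>i. y i + 2 * x i) = (\<lambda>i. 2 * homogeneous_ext f (\<lambda>i. x i + (1/2) * y i) i)"
    using homogeneous_ext_scale [OF add_V [OF x scale_V [OF y]]] by (simp only:)
  then have "A' + C' * 2 = 2 * (A + C * (1/2))"
    using A' [of 2] A [of "1/2"] scale_left [OF homogeneous_ext_V [OF add_V [OF x scale_V [OF y]]] \<eta>]
    by (simp only:)
  moreover have "A' + C' = A + C"
    using A [of 1] A' [of 1] by (simp add: add.commute)
  moreover have "C' = (A' + C' * 2) - (A' + C')" by simp
  ultimately have "C' = 2 * (A + C * (1/2)) - (A + C)" by (simp only:)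
  then have "C' = A" by simp
  with \<open>A' + C' = A + C\<close> have "A' = C" by simp
  then have "ip (homogeneous_ext f (\<lambda>i. x i + y i)) \<eta> = ip (\<lambda>i. homogeneous_ext f x i + homogeneous_ext f y i) \<eta>"
    using A [of 0] A [of 1] A' [of 0] x y \<eta> by simp
  then show "ip \<eta> (homogeneous_ext f (\<lambda>i. x i + y i)) = ip \<eta> (\<lambda>i. homogeneous_ext f x i + homogeneous_ext f y i)"
    using commute [OF homogeneous_ext_V \<eta>] commute [OF add_V \<eta>] homogeneous_ext_V x y by simp
qed (use x y in simp_all)

lemma Re_ip_homogeneous_ext:
  assumes x: "x \<in> V" and y: "y \<in> V"
  shows "Re (ip (homogeneous_ext f x) (homogeneous_ext f y)) = Re (ip x y)"
  using N_sq_add [OF x y] N_sq_add [OF homogeneous_ext_V [OF x] homogeneous_ext_V [OF y]]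
    N_homogeneous_ext [OF add_V [OF x y]] x y
  by (simp add: homogeneous_ext_add)

text \<open>Polarization gives real parts; replacing \<open>y\<close> by its multiple by \<i> turns
  the real part into the imaginary one.\<close>

lemma ip_homogeneous_ext:
  assumes x: "x \<in> V" and y: "y \<in> V"
  shows "ip (homogeneous_ext f x) (homogeneous_ext f y) = ip x y"
proof -
  have "Im (ip (homogeneous_ext f x) (homogeneous_ext f y)) = Im (ip x y)"
    using Re_ip_homogeneous_ext [OF x scale_V [OF y], of \<i>] x y by (simp add: homogeneous_ext_scale)
  then show ?thesis
    using Re_ip_homogeneous_ext [OF x y] by (simp add: complex_eq_iff)
qed

end

context ip_space
begin

text \<open>The Schwarz inequality for \<open>f\<close> and for its left inverse \<open>g\<close>
  gives \<open>N z \<le> N (f z) \<le> N z\<close>, which puts \<open>f\<close> into the locale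
  \<open>schwarz_isometry\<close>.\<close>

lemma cartan:
  assumes f: "line_analytic f" "f \<in> B \<rightarrow> B" "f (\<lambda>i. 0) = (\<lambda>i. 0)"
    and g: "line_analytic g" "g \<in> B \<rightarrow> B" "g (\<lambda>i. 0) = (\<lambda>i. 0)"
    and gf: "\<And>z. z \<in> B \<Longrightarrow> g (f z) = z"
    and z: "z \<in> B" and w: "w \<in> B"
  shows "ip (f z) (f w) = ip z w"
proof -
  have "N (f z) = N z" if "z \<in> B" for z
    using schwarz_norm [OF f that] schwarz_norm [OF g, of "f z"] gf [OF that] f(2) that
    by (auto simp: Pi_iff)
  then interpret schwarz_isometry V ip f
    using f by unfold_locales
  show ?thesis
    using ip_homogeneous_ext [OF B_V [OF z] B_V [OF w]] by (simp add: homogeneous_ext_B z w)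
qed

end

section \<open>The kernel\<close>

lemma powr_eq_imp_eq:
  fixes x y a :: real
  assumes "x > 0" "y > 0" "a \<noteq> 0" "x powr a = y powr a" shows "x = y"
  using assms by (simp add: powr_def)

text \<open>As \<open>p\<close> is a positive real, only four of the five logarithms have an imaginary part, and these lie
  in \<open>(-\<pi>/2, \<pi>/2)\<close>. So the imaginary parts of the two sides differ by less than \<open>2\<pi>\<close>, and no
  branch is crossed.\<close>

lemma powr_cross_ratio:
  fixes p q r s T c :: complex
  assumes p: "Re p > 0" "Im p = 0" and pos: "Re q > 0" "Re r > 0" "Re s > 0" "Re T > 0"
    and T: "T = p * q / (r * s)"
  shows "T powr c = p powr c * q powr c / (r powr c * s powr c)"
proof -
  have nz: "p \<noteq> 0" "q \<noteq> 0" "r \<noteq> 0" "s \<noteq> 0" "T \<noteq> 0" using p pos by auto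
  have L: "Ln T = Ln p + Ln q - (Ln r + Ln s)"
  proof (rule exp_complex_eqI)
    show "exp (Ln T) = exp (Ln p + Ln q - (Ln r + Ln s))"
      using nz T by (simp add: exp_add exp_diff)
    have "Im (Ln p) = 0" using p nz by (simp add: Im_Ln_eq_0)
    then show "\<bar>Im (Ln T) - Im (Ln p + Ln q - (Ln r + Ln s))\<bar> < 2 * pi"
      using pos [THEN Re_Ln_pos_lt_imp] by (simp; linarith)
  qed
  have "c * Ln T = c * Ln p + c * Ln q - (c * Ln r + c * Ln s)"
    unfolding L by (simp only: distrib_left right_diff_distrib)
  then show ?thesis
    using nz by (simp add: powr_def exp_add exp_diff)
qed

text \<open>Near \<open>u = 0\<close> the imaginary part of \<open>Ln (1 - u)\<close> is below
  \<open>pi / \<gamma>\<close> in modulus. After multiplication by \<open>-\<gamma>\<close> two such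
  logarithms differ by less than 2 pi in imaginary part, where \<open>exp\<close> is
  injective.\<close>

lemma powr_inj_near_1:
  fixes \<gamma> :: real
  assumes "\<gamma> > 0"
  obtains e where "e > 0" "\<And>u v. cmod u < e \<Longrightarrow> cmod v < e \<Longrightarrow>
    (1 - u) powr (- of_real \<gamma>) = (1 - v) powr (- of_real \<gamma>) \<Longrightarrow> u = v"
proof -
  have "isCont (\<lambda>u. Ln (1 - u)) 0"
    by (intro continuous_intros) auto
  then obtain d where d: "d > 0" "\<And>u. cmod u < d \<Longrightarrow> cmod (Ln (1 - u)) < pi / \<gamma>"
    unfolding continuous_at_eps_delta using assms
    by (auto simp: dist_norm dest!: spec [of _ "pi / \<gamma>"])
  show ?thesis
  proof (rule that [of "min d 1"])
    show "min d 1 > 0" using d by simp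
    fix u v :: complex
    assume u: "cmod u < min d 1" and v: "cmod v < min d 1"
      and eq: "(1 - u) powr (- of_real \<gamma>) = (1 - v) powr (- of_real \<gamma>)"
    have nz: "1 - u \<noteq> 0" "1 - v \<noteq> 0" using u v by auto
    have "- of_real \<gamma> * Ln (1 - u) = - of_real \<gamma> * Ln (1 - v)"
    proof (rule exp_complex_eqI)
      show "exp (- of_real \<gamma> * Ln (1 - u)) = exp (- of_real \<gamma> * Ln (1 - v))"
        using eq nz by (simp add: powr_def)
      have "\<bar>Im (Ln (1 - u))\<bar> < pi / \<gamma>" "\<bar>Im (Ln (1 - v))\<bar> < pi / \<gamma>"
        using d(2) [of u] d(2) [of v] u v abs_Im_le_cmod order_le_less_trans by auto
      then have "\<gamma> * \<bar>Im (Ln (1 - u))\<bar> < pi" "\<gamma> * \<bar>Im (Ln (1 - v))\<bar> < pi"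
        using assms by (simp_all add: field_simps)
      then have "\<bar>\<gamma> * Im (Ln (1 - u))\<bar> < pi" "\<bar>\<gamma> * Im (Ln (1 - v))\<bar> < pi"
        using assms by (simp_all add: abs_mult)
      then show "\<bar>Im (- of_real \<gamma> * Ln (1 - u)) - Im (- of_real \<gamma> * Ln (1 - v))\<bar> < 2 * pi"
        by (simp add: abs_less_iff)
    qed
    then have "Ln (1 - u) = Ln (1 - v)" using assms by simp
    then have "exp (Ln (1 - u)) = exp (Ln (1 - v))" by simp
    then show "u = v" using nz by simp
  qed
qed

context ip_space
begin

abbreviation kern :: "real \<Rightarrow> ('a \<Rightarrow> complex) \<Rightarrow> ('a \<Rightarrow> complex) \<Rightarrow> complex" where
  "kern \<gamma> z w \<equiv> (1 - ip z w) powr (- complex_of_real \<gamma>)"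

lemma kern_nz: "z \<in> B \<Longrightarrow> w \<in> B \<Longrightarrow> kern \<gamma> z w \<noteq> 0"
  using ip_B_neq_1 [of z w] by (simp add: powr_def)

lemma kern_0 [simp]: "z \<in> V \<Longrightarrow> kern \<gamma> z (\<lambda>i. 0) = 1" "z \<in> V \<Longrightarrow> kern \<gamma> (\<lambda>i. 0) z = 1"
  by simp_all

lemma kern_cnj:
  assumes "z \<in> B" "w \<in> B" shows "cnj (kern \<gamma> z w) = kern \<gamma> w z"
proof -
  have "cnj (kern \<gamma> z w) = cnj (1 - ip z w) powr cnj (- complex_of_real \<gamma>)"
    using Re_1_ip_B [OF assms] by (intro cnj_powr) simp
  then show ?thesis
    using commute [OF B_V B_V, OF assms] by simp
qed

lemma norm_kern: "cmod (kern \<gamma> z w) = cmod (1 - ip z w) powr (- \<gamma>)"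
  by (subst norm_powr_real_powr') auto

lemma one_minus_ip_self: "a \<in> B \<Longrightarrow> 1 - ip a a = complex_of_real (1 - (N a)\<^sup>2)"
  by (simp add: ip_self)

lemma kern_diag:
  assumes "a \<in> B"
  shows "kern \<gamma> a a = complex_of_real ((1 - (N a)\<^sup>2) powr (- \<gamma>))" and "(1 - (N a)\<^sup>2) powr (- \<gamma>) > 0"
proof -
  have pos: "1 - (N a)\<^sup>2 > 0" using N_sq_less_1 [OF assms] by simp
  then show "(1 - (N a)\<^sup>2) powr (- \<gamma>) > 0" by simp
  show "kern \<gamma> a a = complex_of_real ((1 - (N a)\<^sup>2) powr (- \<gamma>))"
    unfolding one_minus_ip_self [OF assms] of_real_minus [symmetric]
    by (rule powr_of_real) (use pos in simp)
qed

lemma kern_moebius: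
  assumes "b \<in> B" "x \<in> B" "y \<in> B"
  shows "kern \<gamma> (moebius b x) (moebius b y) = kern \<gamma> b b * kern \<gamma> x y / (kern \<gamma> x b * kern \<gamma> b y)"
proof (rule powr_cross_ratio [OF _ _ _ _ _ _ moebius_identity [OF assms]])
  show "Im (1 - ip b b) = 0" by (simp add: one_minus_ip_self [OF assms(1)])
qed (intro Re_1_ip_B moebius_B assms)+

text \<open>Moduli suffice, so the branch is irrelevant. Taking \<open>u = p\<close> and
  \<open>u = q\<close> shows that \<open>1 - (N p)\<^sup>2\<close> and
  \<open>1 - (N q)\<^sup>2\<close> both equal \<open>cmod (1 - ip p q)\<close>, which is at least
  \<open>1 - Re (ip p q)\<close>.\<close>

lemma kern_inj:
  assumes \<gamma>: "\<gamma> > 0" and p: "p \<in> B" and q: "q \<in> B"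
    and eq: "\<And>u. u \<in> B \<Longrightarrow> kern \<gamma> u p = kern \<gamma> u q"
  shows "p = q"
proof -
  have *: "cmod (1 - ip u p) = cmod (1 - ip u q)" if u: "u \<in> B" for u
  proof (rule powr_eq_imp_eq)
    show "cmod (1 - ip u p) powr (- \<gamma>) = cmod (1 - ip u q) powr (- \<gamma>)"
      unfolding norm_kern [symmetric] using eq [OF u] by simp
  qed (use \<gamma> ip_B_neq_1 [OF u p] ip_B_neq_1 [OF u q] in auto)
  have self: "cmod (1 - ip a a) = 1 - (N a)\<^sup>2" if "a \<in> B" for a
    unfolding one_minus_ip_self [OF that] using N_sq_less_1 [OF that] by (simp del: of_real_diff)
  have c: "cmod (1 - ip q p) = cmod (1 - ip p q)"
    unfolding commute [OF B_V B_V, OF p q] by (metis complex_cnj_diff complex_cnj_one complex_mod_cnj)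
  have "1 - Re (ip p q) \<le> cmod (1 - ip p q)"
    using complex_Re_le_cmod [of "1 - ip p q"] by simp
  then have "(N p)\<^sup>2 + (N q)\<^sup>2 \<le> 2 * Re (ip p q)"
    using * [OF p] * [OF q] c self [OF p] self [OF q] by linarith
  then show ?thesis
    by (rule eq_if_N_diff [OF B_V [OF p] B_V [OF q]])
qed

text \<open>For large \<open>\<gamma>\<close> the kernel determines \<open>ip z w\<close> only when \<open>N z * N w\<close> is small. Shrinking one
  argument by a fixed factor is harmless, because \<open>f\<close> then turns out to commute with that factor.\<close>

lemma kern_isometry_imp_ip_isometry:
  assumes \<gamma>: "\<gamma> > 0" and f: "f \<in> B \<rightarrow> B"
    and eq: "\<And>z w. z \<in> B \<Longrightarrow> w \<in> B \<Longrightarrow> kern \<gamma> (f z) (f w) = kern \<gamma> z w"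
    and z: "z \<in> B" and w: "w \<in> B"
  shows "ip (f z) (f w) = ip z w"
proof -
  have fB: "f x \<in> B" if "x \<in> B" for x using f that by blast
  have Nf: "N (f x) = N x" if x: "x \<in> B" for x
  proof -
    have "(1 - (N (f x))\<^sup>2) powr (- \<gamma>) = (1 - (N x)\<^sup>2) powr (- \<gamma>)"
      using eq [OF x x] unfolding kern_diag(1) [OF fB [OF x]] kern_diag(1) [OF x] of_real_eq_iff .
    then have "1 - (N (f x))\<^sup>2 = 1 - (N x)\<^sup>2"
      using powr_eq_imp_eq N_sq_less_1 [OF x] N_sq_less_1 [OF fB [OF x]] \<gamma> by (smt (verit))
    then show ?thesis
      using x fB [OF x] by simp
  qed
  obtain e where e: "e > 0" "\<And>u v. cmod u < e \<Longrightarrow> cmod v < e \<Longrightarrow>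
    (1 - u) powr (- of_real \<gamma>) = (1 - v) powr (- of_real \<gamma>) \<Longrightarrow> u = v"
    by (rule powr_inj_near_1 [OF \<gamma>]) (rule that)
  have small: "ip (f x) (f y) = ip x y" if x: "x \<in> B" and y: "y \<in> B" and xy: "N x * N y < e" for x y
  proof (rule e(2))
    show "cmod (ip (f x) (f y)) < e"
      using Cauchy_Schwarz [OF B_V [OF fB [OF x]] B_V [OF fB [OF y]]] xy
      unfolding Nf [OF x] Nf [OF y] by linarith
    show "cmod (ip x y) < e"
      using Cauchy_Schwarz [OF B_V [OF x] B_V [OF y]] xy by linarith
    show "kern \<gamma> (f x) (f y) = kern \<gamma> x y" by (rule eq [OF x y])
  qed
  \<comment> \<open>With this factor \<open>N ?tz * N u \<le> t < e\<close> for every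
    \<open>u\<close> in the ball, so \<open>small\<close> applies to \<open>?tz\<close> paired with
    \<open>z\<close> as well as with \<open>w\<close>.\<close>
  define t where "t = min (e/2) 1"
  have t: "t > 0" "t < e" "t \<le> 1" using e(1) by (auto simp: t_def)
  let ?tz = "\<lambda>i. complex_of_real t * z i"
  have tz: "?tz \<in> B" by (rule scale_B [OF z]) (use t in simp)
  have st: "ip (f ?tz) (f u) = of_real t * ip z u" if u: "u \<in> B" for u
  proof -
    have "N z * N u \<le> 1 * 1"
      using B_N [OF z] B_N [OF u] B_V [OF z] B_V [OF u] by (intro mult_mono) auto
    then have "N ?tz * N u \<le> t"
      unfolding N_scale [OF B_V [OF z]] using t(1) by (simp add: mult.assoc mult_left_le)
    then have "N ?tz * N u < e" using t(2) by linarith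
    then have "ip (f ?tz) (f u) = ip ?tz u" by (rule small [OF tz u])
    then show ?thesis unfolding scale_left [OF B_V [OF z] B_V [OF u]] .
  qed
  have "f ?tz = (\<lambda>i. of_real t * f z i)"
  proof (rule eq_if_N_diff)
    have "ip (f ?tz) (\<lambda>i. of_real t * f z i) = of_real (t * (t * (N z)\<^sup>2))"
      unfolding scale_right [OF B_V [OF fB [OF z]] B_V [OF fB [OF tz]]] st [OF z] ip_self [OF B_V [OF z]]
      by simp
    then have "Re (ip (f ?tz) (\<lambda>i. of_real t * f z i)) = t * (t * (N z)\<^sup>2)"
      by (simp only: Re_complex_of_real)
    then show "(N (f ?tz))\<^sup>2 + (N (\<lambda>i. of_real t * f z i))\<^sup>2 \<le> 2 * Re (ip (f ?tz) (\<lambda>i. of_real t * f z i))"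
      unfolding Nf [OF tz] N_scale [OF B_V [OF z]] N_scale [OF B_V [OF fB [OF z]]] Nf [OF z]
      by (simp add: power_mult_distrib power2_eq_square)
  qed (use fB tz z in simp_all)
  then have "of_real t * ip (f z) (f w) = of_real t * ip z w"
    using st [OF w] scale_left [OF B_V [OF fB [OF z]] B_V [OF fB [OF w]], of "of_real t"] by simp
  then show ?thesis using t(1) by simp
qed

text \<open>With \<open>?G\<close> the combination of the images, \<open>ip ?G ?G\<close>,
  \<open>ip (f ?Z) ?G\<close> and \<open>ip (f ?Z) (f ?Z)\<close> can all be computed from inner
  products of images of ball points, and all equal \<open>ip ?Z ?Z\<close>. So \<open>f ?Z\<close>
  and \<open>?G\<close> have distance 0.\<close>

lemma ip_isometry_linear:
  assumes f: "f \<in> B \<rightarrow> B" and iso: "\<And>z w. z \<in> B \<Longrightarrow> w \<in> B \<Longrightarrow> ip (f z) (f w) = ip z w"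
    and x: "x \<in> B" and y: "y \<in> B" and Z: "(\<lambda>i. x i + c * y i) \<in> B"
  shows "f (\<lambda>i. x i + c * y i) = (\<lambda>i. f x i + c * f y i)"
proof -
  let ?Z = "\<lambda>i. x i + c * y i" and ?G = "\<lambda>i. f x i + c * f y i"
  have fV: "f z \<in> V" if "z \<in> B" for z using f that by (intro B_V) blast
  have GV: "?G \<in> V" by (intro add_V scale_V fV x y)
  have ZV: "?Z \<in> V" by (rule B_V [OF Z])
  have r: "ip g ?G = ip g (f x) + cnj c * ip g (f y)" if "g \<in> V" for g
    by (simp only: add_right [OF fV [OF x] scale_V [OF fV [OF y]] that] scale_right [OF fV [OF y] that])
  have l: "ip ?G (f h) = ip ?Z h" if "h \<in> B" for h
    by (simp only: add_left [OF fV [OF x] scale_V [OF fV [OF y]] fV [OF that]] iso x y that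
        scale_left [OF fV [OF y] fV [OF that]]
        add_left [OF B_V [OF x] scale_V [OF B_V [OF y]] B_V [OF that]] scale_left [OF B_V [OF y] B_V [OF that]])
  have ZZ: "ip ?Z ?Z = ip ?Z x + cnj c * ip ?Z y"
    by (simp only: add_right [OF B_V [OF x] scale_V [OF B_V [OF y]] ZV] scale_right [OF B_V [OF y] ZV])
  have GG: "ip ?G ?G = ip ?Z ?Z" unfolding r [OF GV] l [OF x] l [OF y] ZZ ..
  have FG: "ip (f ?Z) ?G = ip ?Z ?Z"
    unfolding r [OF fV [OF Z]] iso [OF Z x] iso [OF Z y] ZZ ..
  have "(N (f ?Z))\<^sup>2 + (N ?G)\<^sup>2 \<le> 2 * Re (ip (f ?Z) ?G)"
    unfolding N_square [OF fV [OF Z]] N_square [OF GV] GG FG iso [OF Z Z] by simp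
  then show ?thesis
    by (rule eq_if_N_diff [OF fV [OF Z] GV])
qed

section \<open>Closure properties of holomorphy along lines\<close>

lemma line_analytic_cong:
  assumes "line_analytic f" "\<And>z. z \<in> B \<Longrightarrow> f z = g z" shows "line_analytic g"
  unfolding line_analytic_def
proof (intro ballI)
  fix z \<xi> \<eta> assume z: "z \<in> B" and \<xi>: "\<xi> \<in> V" and \<eta>: "\<eta> \<in> V"
  have "(\<lambda>t. ip (f (\<lambda>i. z i + t * \<xi> i)) \<eta>) analytic_on {0}"
    using assms(1) [unfolded line_analytic_def, rule_format, OF z \<xi> \<eta>] .
  moreover have "\<forall>\<^sub>F t in nhds 0. ip (f (\<lambda>i. z i + t * \<xi> i)) \<eta> = ip (g (\<lambda>i. z i + t * \<xi> i)) \<eta>"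
    using eventually_line_B [OF z \<xi>] by eventually_elim (simp add: assms(2))
  ultimately show "(\<lambda>t. ip (g (\<lambda>i. z i + t * \<xi> i)) \<eta>) analytic_on {0}"
    by (subst (asm) analytic_at_cong [OF _ refl]) auto
qed

lemma line_analytic_id: "line_analytic (\<lambda>z. z)"
  unfolding line_analytic_def
proof (intro ballI)
  fix z \<xi> \<eta> assume z: "z \<in> B" and \<xi>: "\<xi> \<in> V" and \<eta>: "\<eta> \<in> V"
  have "(\<lambda>t. ip z \<eta> + t * ip \<xi> \<eta>) analytic_on {0}" by (intro analytic_intros)
  then show "(\<lambda>t. ip (\<lambda>i. z i + t * \<xi> i) \<eta>) analytic_on {0}"
    by (simp only: add_left [OF B_V [OF z] scale_V [OF \<xi>] \<eta>] scale_left [OF \<xi> \<eta>])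
qed

text \<open>\<open>ip (moebius b x) \<eta>\<close> is a rational expression in \<open>ip x b\<close>
  and \<open>ip x \<eta>\<close>, and both are analytic when \<open>x\<close> runs through the image
  of a line under \<open>f\<close>.\<close>

lemma line_analytic_moebius:
  assumes f: "line_analytic f" "f \<in> B \<rightarrow> B" and b: "b \<in> B"
  shows "line_analytic (\<lambda>z. moebius b (f z))"
  unfolding line_analytic_def
proof (intro ballI)
  fix z \<xi> \<eta> assume z: "z \<in> B" and \<xi>: "\<xi> \<in> V" and \<eta>: "\<eta> \<in> V"
  let ?h = "\<lambda>t \<eta>. ip (f (\<lambda>i. z i + t * \<xi> i)) \<eta>"
  have an: "(\<lambda>t. ?h t \<eta>) analytic_on {0}" if "\<eta> \<in> V" for \<eta>
    using f(1) [unfolded line_analytic_def, rule_format, OF z \<xi> that] .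
  have "(\<lambda>t. (1 - ?h t b / (1 + moebius_scale b)) / (1 - ?h t b) * ip b \<eta> - moebius_scale b / (1 - ?h t b) * ?h t \<eta>)
      analytic_on {0}"
  proof (intro analytic_intros an \<eta> B_V [OF b])
    have "f z \<in> B" using f(2) z by blast
    then show "1 - ?h t b \<noteq> 0" if "t \<in> {0}" for t
      using that ip_B_neq_1 [OF _ b] by simp
    then show "1 - ?h t b \<noteq> 0" if "t \<in> {0}" for t
      using that by simp
    show "1 + moebius_scale b \<noteq> 0" by (rule moebius_scale_nz(2) [OF b])
  qed
  moreover have "\<forall>\<^sub>F t in nhds 0. (1 - ?h t b / (1 + moebius_scale b)) / (1 - ?h t b) * ip b \<eta>
      - moebius_scale b / (1 - ?h t b) * ?h t \<eta> = ip (moebius b (f (\<lambda>i. z i + t * \<xi> i))) \<eta>"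
    using eventually_line_B [OF z \<xi>]
  proof eventually_elim
    case (elim t)
    then have "f (\<lambda>i. z i + t * \<xi> i) \<in> V" by (intro B_V funcset_mem [OF f(2)])
    then show ?case by (rule ip_moebius_left [OF B_V [OF b] _ \<eta>, symmetric])
  qed
  ultimately show "(\<lambda>t. ip (moebius b (f (\<lambda>i. z i + t * \<xi> i))) \<eta>) analytic_on {0}"
    by (subst (asm) analytic_at_cong [OF _ refl]) auto
qed

text \<open>\<open>moebius a\<close> maps complex lines to complex lines, which makes up for the lack of a chain rule for
  maps that are only known to be holomorphic along lines.\<close>

lemma line_analytic_comp_moebius:
  assumes f: "line_analytic f" and a: "a \<in> B"
  shows "line_analytic (\<lambda>z. f (moebius a z))"
  unfolding line_analytic_def
proof (intro ballI)
  fix z \<xi> \<eta> assume z: "z \<in> B" and \<xi>: "\<xi> \<in> V" and \<eta>: "\<eta> \<in> V"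
  define p q s where "p = ip z a" and "q = ip \<xi> a" and "s = moebius_scale a"
  \<comment> \<open>\<open>\<tau>\<close> and \<open>\<zeta>\<close> are chosen so that
    \<open>moebius a\<close> sends \<open>z + t \<xi>\<close> to
    \<open>moebius a z + \<tau> t \<zeta>\<close>: the denominator
    \<open>1 - ip (z + t \<xi>) a\<close> goes into the new parameter \<open>\<tau>\<close>, and
    what remains is a direction independent of \<open>t\<close>.\<close>
  define \<tau> where "\<tau> t = t / (1 - p - t * q)" for t
  define \<zeta> where "\<zeta> = (\<lambda>i. (q * moebius a z i - q / (1 + s) * a i) - s * \<xi> i)"
  have p: "1 - p \<noteq> 0" unfolding p_def by (rule ip_B_neq_1 [OF z a])
  have \<zeta>: "\<zeta> \<in> V" unfolding \<zeta>_def
    by (intro diff_V scale_V moebius_V B_V [OF a] B_V [OF z] \<xi>)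
  have \<tau>: "\<tau> analytic_on {0}"
    unfolding \<tau>_def using p by (intro analytic_intros) simp
  have "(\<lambda>u. ip (f (\<lambda>i. moebius a z i + u * \<zeta> i)) \<eta>) analytic_on {0}"
    using f [unfolded line_analytic_def, rule_format, OF moebius_B [OF a z] \<zeta> \<eta>] .
  then have "((\<lambda>u. ip (f (\<lambda>i. moebius a z i + u * \<zeta> i)) \<eta>) \<circ> \<tau>) analytic_on {0}"
    by (intro analytic_on_compose [OF \<tau>]) (simp add: \<tau>_def)
  moreover have "\<forall>\<^sub>F t in nhds 0. ((\<lambda>u. ip (f (\<lambda>i. moebius a z i + u * \<zeta> i)) \<eta>) \<circ> \<tau>) t
      = ip (f (moebius a (\<lambda>i. z i + t * \<xi> i))) \<eta>"
    using eventually_line_B [OF z \<xi>]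
  proof eventually_elim
    case (elim t)
    have ipa: "ip (\<lambda>i. z i + t * \<xi> i) a = p + t * q"
      unfolding p_def q_def
      by (simp only: add_left [OF B_V [OF z] scale_V [OF \<xi>] B_V [OF a]] scale_left [OF \<xi> B_V [OF a]])
    have D: "1 - p - t * q \<noteq> 0"
      using ip_B_neq_1 [OF elim a] unfolding ipa by (simp add: algebra_simps)
    have *: "M + t / D * ((q * M - q / r * x) - s * y)
        = (1 - (p + t * q) / r) / D * x - s / D * (w + t * y)"
      if "M = (1 - p / r) / D0 * x - s / D0 * w" "D = D0 - t * q" "D \<noteq> 0" "D0 \<noteq> 0"
      for M D D0 r x y w
    proof -
      have M: "D0 * M = (1 - p / r) * x - s * w"
        using that(1,4) by (simp add: right_diff_distrib)
      have "D * (M + t / D * ((q * M - q / r * x) - s * y)) = D * M + t * ((q * M - q / r * x) - s * y)"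
        using that(3) by (simp add: distrib_left)
      also have "\<dots> = D0 * M - t * (q / r) * x - t * s * y"
        unfolding that(2) by (simp add: algebra_simps)
      also have "\<dots> = (1 - (p + t * q) / r) * x - s * (w + t * y)"
        unfolding M by (simp add: algebra_simps add_divide_distrib)
      finally show ?thesis
        using that(3) by (simp add: divide_simps mult.commute)
    qed
    have "moebius a z i + \<tau> t * \<zeta> i = moebius a (\<lambda>i. z i + t * \<xi> i) i" for i
      unfolding \<zeta>_def \<tau>_def moebius_def [of a "\<lambda>i. z i + t * \<xi> i"] ipa s_def [symmetric]
      using * [of "moebius a z i" "1 + s" "1 - p" "a i" "z i" "1 - p - t * q" "\<xi> i"] D p
      by (simp add: moebius_def [of a z] p_def s_def diff_diff_eq)
    then show ?case by simp
  qed
  ultimately show "(\<lambda>t. ip (f (moebius a (\<lambda>i. z i + t * \<xi> i))) \<eta>) analytic_on {0}"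
    by (subst (asm) analytic_at_cong [OF _ refl]) auto
qed

text \<open>The adjoint moves \<open>h\<close> onto the test vector, which does not depend on
  \<open>t\<close>. The vector \<open>\<eta>\<close> is first scaled into the ball because
  adjointness is assumed only there.\<close>

lemma line_analytic_adjoint:
  assumes g: "line_analytic g" "g \<in> B \<rightarrow> B" and h: "h \<in> B \<rightarrow> B" "h' \<in> B \<rightarrow> B"
    and adj: "\<And>x y. x \<in> B \<Longrightarrow> y \<in> B \<Longrightarrow> ip (h x) y = ip x (h' y)"
  shows "line_analytic (\<lambda>z. h (g z))"
  unfolding line_analytic_def
proof (intro ballI)
  fix z \<xi> \<eta> assume z: "z \<in> B" and \<xi>: "\<xi> \<in> V" and \<eta>: "\<eta> \<in> V"
  obtain R :: real where R: "R > 0" and \<eta>B: "(\<lambda>i. of_real (1/R) * \<eta> i) \<in> B" (is "?\<eta> \<in> B")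
    by (rule scale_to_B [OF \<eta>]) (rule that)
  have h'V: "h' ?\<eta> \<in> V" by (intro B_V funcset_mem [OF h(2)] \<eta>B)
  have "(\<lambda>t. ip (g (\<lambda>i. z i + t * \<xi> i)) (h' ?\<eta>)) analytic_on {0}"
    using g(1) [unfolded line_analytic_def, rule_format, OF z \<xi> h'V] .
  then have "(\<lambda>t. of_real R * ip (g (\<lambda>i. z i + t * \<xi> i)) (h' ?\<eta>)) analytic_on {0}"
    by (intro analytic_intros)
  moreover have "\<forall>\<^sub>F t in nhds 0. of_real R * ip (g (\<lambda>i. z i + t * \<xi> i)) (h' ?\<eta>)
      = ip (h (g (\<lambda>i. z i + t * \<xi> i))) \<eta>"
    using eventually_line_B [OF z \<xi>]
  proof eventually_elim
    case (elim t)
    then have gB: "g (\<lambda>i. z i + t * \<xi> i) \<in> B" by (rule funcset_mem [OF g(2)])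
    have hV: "h (g (\<lambda>i. z i + t * \<xi> i)) \<in> V" by (intro B_V funcset_mem [OF h(1)] gB)
    show ?case
      unfolding adj [OF gB \<eta>B, symmetric] scale_right [OF \<eta> hV] using R by simp
  qed
  ultimately show "(\<lambda>t. ip (h (g (\<lambda>i. z i + t * \<xi> i))) \<eta>) analytic_on {0}"
    by (subst (asm) analytic_at_cong [OF _ refl]) auto
qed

end

section \<open>Weighted composition operators on reproducing kernel Hilbert spaces\<close>

context complex_hilbert_space
begin

text \<open>Orthogonal projection onto the closure of \<open>M\<close>, delivered as the limit of a
  minimizing sequence in \<open>M\<close>, so that the closure itself is never formed.\<close>

lemma approx_projection:
  assumes M: "M \<subseteq> V" "(\<lambda>x. 0) \<in> M"
    and lin: "\<And>m m' c. m \<in> M \<Longrightarrow> m' \<in> M \<Longrightarrow> (\<lambda>x. m x + c * m' x) \<in> M"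
    and f: "f \<in> V"
  obtains s l where "\<And>n. s n \<in> M" "l \<in> V" "(\<lambda>n. N (\<lambda>x. s n x - l x)) \<longlonglongrightarrow> 0"
    "\<And>m. m \<in> M \<Longrightarrow> ip (\<lambda>x. f x - l x) m = 0"
proof -
  define D where "D = (INF m\<in>M. (N (\<lambda>x. f x - m x))\<^sup>2)"
  have MV: "m \<in> V" if "m \<in> M" for m using subsetD [OF M(1) that] .
  have D: "D \<le> (N (\<lambda>x. f x - m x))\<^sup>2" if "m \<in> M" for m
    unfolding D_def by (rule cINF_lower [OF bdd_belowI2 [of _ 0] that]) simp
  have "\<exists>m\<in>M. (N (\<lambda>x. f x - m x))\<^sup>2 < D + inverse (real (Suc n))" for n
  proof -
    have "D < D + inverse (real (Suc n))" by simp
    then show ?thesis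
      unfolding D_def using M(2) by (subst (asm) cINF_less_iff) (auto intro: bdd_belowI2 [of _ 0])
  qed
  then obtain s where s: "\<And>n. s n \<in> M"
    and sD: "\<And>n. (N (\<lambda>x. f x - s n x))\<^sup>2 < D + inverse (real (Suc n))"
    by metis
  have sV: "s n \<in> V" for n using MV [OF s] .
  have cauchy: "(N (\<lambda>x. s m x - s n x))\<^sup>2 < 2 * inverse (real (Suc m)) + 2 * inverse (real (Suc n))" for m n
  proof -
    let ?a = "\<lambda>x. f x - s m x" and ?b = "\<lambda>x. f x - s n x"
    have ab: "?a \<in> V" "?b \<in> V" using f sV by simp_all
    \<comment> \<open>The midpoint of \<open>s m\<close> and \<open>s n\<close> is in
      \<open>M\<close>, so its squared distance to \<open>f\<close> is at least \<open>D\<close>;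
      the parallelogram law then bounds the distance of \<open>s m\<close> and \<open>s n\<close>.
      The summand 0 lets \<open>lin\<close> be applied twice.\<close>
    have mid: "(\<lambda>x. (0 + (1/2) * s m x) + (1/2) * s n x) \<in> M"
      using lin [OF lin [OF M(2) s] s, of "1/2" m "1/2" n] .
    have "(\<lambda>x. ?a x + ?b x) = (\<lambda>x. 2 * (f x - ((0 + (1/2) * s m x) + (1/2) * s n x)))"
      by (simp add: fun_eq_iff)
    then have "(N (\<lambda>x. ?a x + ?b x))\<^sup>2 = 4 * (N (\<lambda>x. f x - ((0 + (1/2) * s m x) + (1/2) * s n x)))\<^sup>2"
      by (simp only: N_scale [OF diff_V [OF f MV [OF mid]]]) (simp add: power_mult_distrib)
    then have "4 * D \<le> (N (\<lambda>x. ?a x + ?b x))\<^sup>2"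
      using D [OF mid] by linarith
    moreover have "(\<lambda>x. s m x - s n x) = (\<lambda>x. ?b x - ?a x)" by simp
    then have "(N (\<lambda>x. s m x - s n x))\<^sup>2 = (N (\<lambda>x. ?a x - ?b x))\<^sup>2"
      by (simp only: N_commute [OF ab])
    ultimately show ?thesis
      using sD [of m] sD [of n] N_sq_add [OF ab] N_sq_diff [OF ab] by linarith
  qed
  have "\<exists>l\<in>V. (\<lambda>n. N (\<lambda>x. s n x - l x)) \<longlonglongrightarrow> 0"
  proof (rule complete [OF sV])
    fix e :: real assume e: "e > 0"
    obtain k where k: "inverse (real (Suc k)) < e\<^sup>2 / 4"
      using reals_Archimedean [of "e\<^sup>2/4"] e by auto
    show "\<exists>k. \<forall>m\<ge>k. \<forall>n\<ge>k. N (\<lambda>x. s m x - s n x) < e"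
    proof (intro exI allI impI)
      fix m n assume "k \<le> m" "k \<le> n"
      then have "inverse (real (Suc m)) \<le> inverse (real (Suc k))"
        "inverse (real (Suc n)) \<le> inverse (real (Suc k))" by (simp_all add: le_imp_inverse_le)
      then have "(N (\<lambda>x. s m x - s n x))\<^sup>2 < e\<^sup>2"
        using cauchy [of m n] k by linarith
      then show "N (\<lambda>x. s m x - s n x) < e"
        by (rule power2_less_imp_less) (use e in simp)
    qed
  qed
  then obtain l where l: "l \<in> V" "(\<lambda>n. N (\<lambda>x. s n x - l x)) \<longlonglongrightarrow> 0" by blast
  have "ip (\<lambda>x. f x - l x) m = 0" if m: "m \<in> M" for m
  proof -
    have mV: "m \<in> V" using MV m .
    have bound: "(cmod (ip (\<lambda>x. f x - s n x) m))\<^sup>2 \<le> inverse (real (Suc n)) * ((N m)\<^sup>2 + 1)" for n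
    proof -
      let ?a = "\<lambda>x. f x - s n x"
      have aV: "?a \<in> V" using f sV by simp
      define k where "k = ip ?a m"
      \<comment> \<open>The optimal step along \<open>m\<close> would have length factor
        \<open>1 / (N m)\<^sup>2\<close>; adding 1 admits \<open>N m = 0\<close> and still lowers
        the squared distance by at least \<open>t * (cmod k)\<^sup>2\<close>.\<close>
      define t where "t = inverse ((N m)\<^sup>2 + 1)"
      have t: "t > 0" "t * ((N m)\<^sup>2 + 1) = 1" unfolding t_def
        by (auto simp: add_nonneg_pos add_nonneg_eq_0_iff)
      have "(\<lambda>x. f x - (s n x + (of_real t * k) * m x)) = (\<lambda>x. ?a x - (of_real t * k) * m x)"
        by (simp add: algebra_simps)
      then have "D \<le> (N (\<lambda>x. ?a x - (of_real t * k) * m x))\<^sup>2"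
        using D [OF lin [OF s m, of n "of_real t * k"]] by (simp only:)
      also have "\<dots> = (N ?a)\<^sup>2 + (N (\<lambda>x. (of_real t * k) * m x))\<^sup>2
          - 2 * Re (ip ?a (\<lambda>x. (of_real t * k) * m x))"
        by (rule N_sq_diff [OF aV scale_V [OF mV]])
      also have "N (\<lambda>x. (of_real t * k) * m x) = t * cmod k * N m"
        using t(1) by (simp add: N_scale [OF mV] norm_mult)
      also have "ip ?a (\<lambda>x. (of_real t * k) * m x) = of_real t * (k * cnj k)"
        unfolding scale_right [OF mV aV] k_def [symmetric] by simp
      also have "\<dots> = of_real (t * (cmod k)\<^sup>2)"
        by (simp only: complex_norm_square [symmetric] of_real_mult)
      finally have "D \<le> (N ?a)\<^sup>2 + (t * cmod k * N m)\<^sup>2 - 2 * (t * (cmod k)\<^sup>2)"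
        by (simp only: Re_complex_of_real)
      moreover have "(t * cmod k * N m)\<^sup>2 \<le> t * (cmod k)\<^sup>2"
      proof -
        have "(t * cmod k * N m)\<^sup>2 \<le> (t * cmod k * N m)\<^sup>2 + (t * cmod k)\<^sup>2" by simp
        also have "\<dots> = (t * (cmod k)\<^sup>2) * (t * ((N m)\<^sup>2 + 1))"
          by (simp add: power2_eq_square algebra_simps)
        finally show ?thesis using t(2) by simp
      qed
      ultimately have "t * (cmod k)\<^sup>2 \<le> inverse (real (Suc n))"
        using sD [of n] by linarith
      then have "t * (cmod k)\<^sup>2 * ((N m)\<^sup>2 + 1) \<le> inverse (real (Suc n)) * ((N m)\<^sup>2 + 1)"
        by (rule mult_right_mono) simp
      moreover have "t * (cmod k)\<^sup>2 * ((N m)\<^sup>2 + 1) = (cmod k)\<^sup>2"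
        using t(2) by (metis mult.commute mult.left_commute mult_1)
      ultimately show ?thesis unfolding k_def by (simp only:)
    qed
    have "(\<lambda>n. inverse (real (Suc n)) * ((N m)\<^sup>2 + 1)) \<longlonglongrightarrow> 0"
      by (rule tendsto_mult_left_zero [OF LIMSEQ_inverse_real_of_nat])
    then have "(\<lambda>n. (cmod (ip (\<lambda>x. f x - s n x) m))\<^sup>2) \<longlonglongrightarrow> 0"
      by (rule Lim_null_comparison [rotated]) (simp add: bound del: of_nat_Suc)
    then have "(\<lambda>n. ip (\<lambda>x. f x - s n x) m) \<longlonglongrightarrow> 0"
      by (simp add: tendsto_norm_zero_iff)
    then have "(\<lambda>n. ip f m - ip (s n) m) \<longlonglongrightarrow> 0"
      by (simp only: diff_left [OF f sV mV])
    moreover have "(\<lambda>n. ip f m - ip (s n) m) \<longlonglongrightarrow> ip f m - ip l m"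
      by (intro tendsto_diff tendsto_const tendsto_ip_left sV l mV)
    ultimately have "ip f m - ip l m = 0"
      by (metis LIMSEQ_unique)
    then show ?thesis by (simp only: diff_left [OF f l(1) mV])
  qed
  then show ?thesis by (rule that [OF s l])
qed

end

section \<open>The span of the kernel functions and the operators acting on it\<close>

context rkhs
begin

abbreviation ker where "ker w \<equiv> on_set X (\<lambda>z. K z w)"

lemma ip_ker [simp]: "f \<in> H \<Longrightarrow> w \<in> X \<Longrightarrow> ip f (ker w) = f w"
  by (rule reproducing)

lemma ker_H [simp]: "w \<in> X \<Longrightarrow> ker w \<in> H"
  by (rule kernel_mem)

inductive_set kspan where
  kspan_0: "(\<lambda>x. 0) \<in> kspan"
| kspan_step: "f \<in> kspan \<Longrightarrow> w \<in> X \<Longrightarrow> (\<lambda>x. f x + c * ker w x) \<in> kspan"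

lemma kspan_H: "f \<in> kspan \<Longrightarrow> f \<in> H"
  by (induction rule: kspan.induct) simp_all

lemma kspan_lin:
  assumes "f \<in> kspan" "g \<in> kspan" shows "(\<lambda>x. f x + c * g x) \<in> kspan"
  using assms(2)
proof (induction rule: kspan.induct)
  case kspan_0
  then show ?case using assms(1) by simp
next
  case (kspan_step g w d)
  have "(\<lambda>x. (f x + c * g x) + (c * d) * ker w x) \<in> kspan"
    by (rule kspan.kspan_step [OF kspan_step(3,2)])
  then show ?case by (simp add: algebra_simps)
qed

text \<open>The residual \<open>f - l\<close> is orthogonal to every kernel function; by the
  reproducing property this means that it vanishes on \<open>X\<close>.\<close>

lemma kspan_dense:
  assumes f: "f \<in> H"
  obtains s where "\<And>n. s n \<in> kspan" "(\<lambda>n. N (\<lambda>x. s n x - f x)) \<longlonglongrightarrow> 0"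
proof -
  have sub: "kspan \<subseteq> H" using kspan_H by blast
  obtain s l where s: "\<And>n. s n \<in> kspan" and l: "l \<in> H" "(\<lambda>n. N (\<lambda>x. s n x - l x)) \<longlonglongrightarrow> 0"
    and orth: "\<And>m. m \<in> kspan \<Longrightarrow> ip (\<lambda>x. f x - l x) m = 0"
    by (rule approx_projection [OF sub kspan_0 kspan_lin f]) (assumption+, rule that)
  have "f x = l x" for x
  proof (cases "x \<in> X")
    case True
    have "(\<lambda>y. 0 + 1 * ker x y) \<in> kspan" by (rule kspan_step [OF kspan_0 True])
    then have "ip (\<lambda>x. f x - l x) (ker x) = 0" using orth by simp
    then show ?thesis using True f l(1) ip_ker [of "\<lambda>x. f x - l x" x] by simp
  next
    case False
    then show ?thesis using outside [OF f] outside [OF l(1)] by simp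
  qed
  then have "f = l" by auto
  then show ?thesis using that [of s] s l(2) by simp
qed

lemma tendsto_point:
  assumes "\<And>n. s n \<in> H" "l \<in> H" "(\<lambda>n. N (\<lambda>x. s n x - l x)) \<longlonglongrightarrow> 0" "w \<in> X"
  shows "(\<lambda>n. s n w) \<longlonglongrightarrow> l w"
  using tendsto_ip_left [OF assms(1,2) ker_H [OF assms(4)] assms(3)] assms by simp

text \<open>The adjoint need not be constructed: surjectivity provides a preimage \<open>g\<close>
  of \<open>ker w\<close>, the isometry identifies it by testing against all \<open>f\<close>, and
  the identity is \<open>?T g = ker w\<close> evaluated at \<open>z\<close>.\<close>

lemma unitary_kernel_identity:
  assumes \<phi>: "\<phi> \<in> X \<rightarrow> X" and T: "unitary_on H ip (weighted_comp X \<delta> \<phi>)"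
    and z: "z \<in> X" and w: "w \<in> X"
  shows "K z w = \<delta> z * cnj (\<delta> w) * K (\<phi> z) (\<phi> w)"
proof -
  let ?T = "weighted_comp X \<delta> \<phi>"
  have \<phi>w: "\<phi> w \<in> X" using \<phi> w by blast
  have "?T ` H = H" and iso: "\<And>f g. f \<in> H \<Longrightarrow> g \<in> H \<Longrightarrow> ip (?T f) (?T g) = ip f g"
    using T by (simp_all add: unitary_on_def)
  then have TH: "\<And>f. f \<in> H \<Longrightarrow> ?T f \<in> H" and "ker w \<in> ?T ` H" using ker_H [OF w] by auto
  then obtain g where g: "g \<in> H" "?T g = ker w" by auto
  let ?g' = "\<lambda>x. cnj (\<delta> w) * ker (\<phi> w) x"
  have "g = ?g'"
  proof (rule eq_if_ip_eq)
    fix f assume f: "f \<in> H"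
    have "ip f g = ip (?T f) (ker w)" using iso [OF f g(1)] g(2) by simp
    also have "\<dots> = \<delta> w * f (\<phi> w)"
      unfolding ip_ker [OF TH [OF f] w] using w by (simp add: weighted_comp_def on_set_def)
    also have "\<dots> = ip f ?g'" using f \<phi>w by simp
    finally show "ip f g = ip f ?g'" .
  qed (use g \<phi>w in simp_all)
  then have "ker w z = ?T ?g' z" using g(2) by simp
  then show ?thesis
    using z \<phi> by (auto simp: weighted_comp_def on_set_def Pi_iff)
qed

text \<open>The kernel identity says that the operator sends \<open>ker (\<phi> w)\<close> to a
  multiple of \<open>ker w\<close>. As \<phi> is onto, this describes it on every kernel function,
  hence on the span.\<close>

lemma weighted_comp_isometry:
  assumes \<phi>: "\<phi> \<in> X \<rightarrow> X" "X \<subseteq> \<phi> ` X" and \<delta>: "\<And>z. z \<in> X \<Longrightarrow> \<delta> z \<noteq> 0"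
    and id: "\<And>z w. z \<in> X \<Longrightarrow> w \<in> X \<Longrightarrow> K z w = \<delta> z * cnj (\<delta> w) * K (\<phi> z) (\<phi> w)"
  shows "f \<in> H \<Longrightarrow> weighted_comp X \<delta> \<phi> f \<in> H"
    and "f \<in> H \<Longrightarrow> g \<in> H \<Longrightarrow> ip (weighted_comp X \<delta> \<phi> f) (weighted_comp X \<delta> \<phi> g) = ip f g"
proof -
  define T where "T = weighted_comp X \<delta> \<phi>"
  have T: "T f z = (if z \<in> X then \<delta> z * f (\<phi> z) else 0)" for f z
    by (simp add: T_def weighted_comp_def on_set_def)
  have Tadd: "T (\<lambda>x. f x + c * g x) = (\<lambda>x. T f x + c * T g x)"
    and Tdiff: "T (\<lambda>x. f x - g x) = (\<lambda>x. T f x - T g x)" for f g c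
    by (auto simp: T fun_eq_iff algebra_simps)
  have Tker: "T (ker (\<phi> w)) = (\<lambda>x. inverse (cnj (\<delta> w)) * ker w x)" if "w \<in> X" for w
    using that \<phi>(1) \<delta> [OF that] id [OF _ that] by (auto simp: T fun_eq_iff on_set_def Pi_iff)
  \<comment> \<open>The induction keeps \<open>g\<close> general in \<open>H\<close>, with
    \<open>T g \<in> H\<close> as a premise because that is not yet known. Later the premise is
    discharged and only one argument has to be approximated.\<close>
  have span: "T f \<in> H \<and> (\<forall>g\<in>H. T g \<in> H \<longrightarrow> ip (T g) (T f) = ip g f)" if "f \<in> kspan" for f
    using that
  proof (induction rule: kspan.induct)
    case kspan_0
    have "T (\<lambda>x. 0) = (\<lambda>x. 0)" by (auto simp: T)
    then show ?case by simp
  next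
    case (kspan_step f w c)
    then obtain v where v: "v \<in> X" "w = \<phi> v" using \<phi>(2) by blast
    have fH: "f \<in> H" using kspan_H [OF kspan_step(1)] .
    have Tk: "T (ker w) \<in> H" using v by (simp add: Tker)
    have ipk: "ip (T g) (T (ker w)) = ip g (ker w)" if "g \<in> H" "T g \<in> H" for g
      unfolding v(2) Tker [OF v(1)] using that v kspan_step(2) \<delta> [OF v(1)]
      by (simp add: T)
    show ?case
      unfolding Tadd using kspan_step(2,3) Tk fH ipk by simp
  qed
  have lim: "T f \<in> H \<and> (\<exists>s. (\<forall>n. s n \<in> kspan) \<and> (\<lambda>n. N (\<lambda>x. s n x - f x)) \<longlonglongrightarrow> 0 \<and>
      (\<lambda>n. N (\<lambda>x. T (s n) x - T f x)) \<longlonglongrightarrow> 0)" if f: "f \<in> H" for f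
  proof -
    obtain s where s: "\<And>n. s n \<in> kspan" "(\<lambda>n. N (\<lambda>x. s n x - f x)) \<longlonglongrightarrow> 0"
      by (rule kspan_dense [OF f]) (rule that)
    have sH: "s n \<in> H" and TsH: "T (s n) \<in> H" for n using kspan_H span s(1) by auto
    have iso: "N (\<lambda>x. T (s m) x - T (s n) x) = N (\<lambda>x. s m x - s n x)" for m n
    proof -
      have "(\<lambda>x. s m x + (-1) * s n x) \<in> kspan" by (rule kspan_lin [OF s(1) s(1)])
      then have "(\<lambda>x. s m x - s n x) \<in> kspan" by simp
      then have "ip (T (\<lambda>x. s m x - s n x)) (T (\<lambda>x. s m x - s n x)) = ip (\<lambda>x. s m x - s n x) (\<lambda>x. s m x - s n x)"
        using span [of "\<lambda>x. s m x - s n x"] kspan_H [of "\<lambda>x. s m x - s n x"] by simp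
      then show ?thesis unfolding Tdiff ip_norm_def by (simp only:)
    qed
    have "\<exists>l\<in>H. (\<lambda>n. N (\<lambda>x. T (s n) x - l x)) \<longlonglongrightarrow> 0"
    proof (rule complete [OF TsH])
      fix e :: real assume "e > 0"
      then obtain k where k: "\<And>n. n \<ge> k \<Longrightarrow> N (\<lambda>x. s n x - f x) < e/2"
        using order_tendstoD(2) [OF s(2), of "e/2"] by (auto simp: eventually_sequentially)
      show "\<exists>k. \<forall>m\<ge>k. \<forall>n\<ge>k. N (\<lambda>x. T (s m) x - T (s n) x) < e"
      proof (intro exI allI impI)
        fix m n assume "k \<le> m" "k \<le> n"
        then show "N (\<lambda>x. T (s m) x - T (s n) x) < e"
          unfolding iso using k [of m] k [of n] N_triangle3 [OF sH f sH, of m n] N_commute [OF f sH, of n]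
          by linarith
      qed
    qed
    then obtain l where l: "l \<in> H" "(\<lambda>n. N (\<lambda>x. T (s n) x - l x)) \<longlonglongrightarrow> 0" by blast
    \<comment> \<open>Point evaluations are continuous on \<open>H\<close>, so the norm limit
      \<open>l\<close> is also the pointwise limit of \<open>T (s n)\<close>, which is
      \<open>T f\<close>. This is what places \<open>T f\<close> in \<open>H\<close>.\<close>
    have "l z = T f z" for z
    proof (cases "z \<in> X")
      case True
      then have "\<phi> z \<in> X" using \<phi>(1) by blast
      then have "(\<lambda>n. \<delta> z * s n (\<phi> z)) \<longlonglongrightarrow> \<delta> z * f (\<phi> z)"
        by (intro tendsto_mult tendsto_const tendsto_point sH f s(2))
      moreover have "(\<lambda>n. \<delta> z * s n (\<phi> z)) \<longlonglongrightarrow> l z"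
        using tendsto_point [OF TsH l True] True by (simp add: T)
      ultimately show ?thesis using True LIMSEQ_unique by (auto simp: T)
    next
      case False
      then show ?thesis using outside [OF l(1)] by (simp add: T)
    qed
    then have "l = T f" by auto
    then show ?thesis using l s by blast
  qed
  show TH: "weighted_comp X \<delta> \<phi> f \<in> H" if "f \<in> H" for f
    using lim [OF that] by (simp add: T_def)
  show "ip (weighted_comp X \<delta> \<phi> f) (weighted_comp X \<delta> \<phi> g) = ip f g" if f: "f \<in> H" and g: "g \<in> H" for f g
  proof -
    have TH: "T f \<in> H" "T g \<in> H" using lim f g by auto
    obtain s where s: "\<And>n. s n \<in> kspan" "(\<lambda>n. N (\<lambda>x. s n x - f x)) \<longlonglongrightarrow> 0"
      "(\<lambda>n. N (\<lambda>x. T (s n) x - T f x)) \<longlonglongrightarrow> 0"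
      using lim [OF f] by blast
    have sH: "s n \<in> H" and TsH: "T (s n) \<in> H" for n using kspan_H span s(1) by auto
    have "ip (T (s n)) (T g) = ip (s n) g" for n
      using span [OF s(1)] g TH(2) commute [OF TH(2) TsH] commute [OF g sH] by simp
    then have "(\<lambda>n. ip (s n) g) \<longlonglongrightarrow> ip (T f) (T g)"
      using tendsto_ip_left [OF TsH TH s(3)] by simp
    moreover have "(\<lambda>n. ip (s n) g) \<longlonglongrightarrow> ip f g"
      by (rule tendsto_ip_left [OF sH f g s(2)])
    ultimately show ?thesis using LIMSEQ_unique unfolding T_def by blast
  qed
qed

text \<open>Surjectivity comes from the inverse operator. It is again a weighted composition, with
  \<open>\<psi>\<close> and the weight \<open>\<theta>\<close>, and satisfies the same kind of
  kernel identity, so the isometry lemma shows that it maps \<open>H\<close> into itself.\<close>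

lemma weighted_comp_unitary:
  assumes bij: "bij_betw \<phi> X X" and \<delta>: "\<And>z. z \<in> X \<Longrightarrow> \<delta> z \<noteq> 0"
    and id: "\<And>z w. z \<in> X \<Longrightarrow> w \<in> X \<Longrightarrow> K z w = \<delta> z * cnj (\<delta> w) * K (\<phi> z) (\<phi> w)"
  shows "unitary_on H ip (weighted_comp X \<delta> \<phi>)"
proof -
  let ?T = "weighted_comp X \<delta> \<phi>"
  define \<psi> where "\<psi> = inv_into X \<phi>"
  have \<psi>: "bij_betw \<psi> X X" unfolding \<psi>_def by (rule bij_betw_inv_into [OF bij])
  have \<psi>X: "\<psi> z \<in> X" "\<phi> (\<psi> z) = z" if "z \<in> X" for z
    using that \<psi> bij_betw_inv_into_right [OF bij] by (auto simp: bij_betw_def \<psi>_def)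
  have \<psi>\<phi>: "\<phi> z \<in> X" "\<psi> (\<phi> z) = z" if "z \<in> X" for z
    using that bij bij_betw_inv_into_left [OF bij] by (auto simp: bij_betw_def \<psi>_def)
  define \<theta> where "\<theta> z = inverse (\<delta> (\<psi> z))" for z
  note iso = weighted_comp_isometry [of \<phi> \<delta>, OF _ _ \<delta> id]
  have \<phi>': "\<phi> \<in> X \<rightarrow> X" "X \<subseteq> \<phi> ` X" using bij by (auto simp: bij_betw_def)
  have \<psi>': "\<psi> \<in> X \<rightarrow> X" "X \<subseteq> \<psi> ` X" using \<psi> by (auto simp: bij_betw_def)
  have inv_H: "weighted_comp X \<theta> \<psi> f \<in> H" if "f \<in> H" for f
  proof (rule weighted_comp_isometry(1) [OF \<psi>' _ _ that])
    show "\<theta> z \<noteq> 0" if "z \<in> X" for z using that \<psi>X \<delta> by (simp add: \<theta>_def)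
    show "K z w = \<theta> z * cnj (\<theta> w) * K (\<psi> z) (\<psi> w)" if "z \<in> X" "w \<in> X" for z w
      using that \<psi>X \<delta> id [of "\<psi> z" "\<psi> w"] by (simp add: \<theta>_def field_simps)
  qed
  have TT: "?T (weighted_comp X \<theta> \<psi> f) = f" if "f \<in> H" for f
    using outside [OF that] \<psi>\<phi> \<delta> by (auto simp: weighted_comp_def on_set_def \<theta>_def fun_eq_iff)
  have "?T ` H = H"
  proof
    show "?T ` H \<subseteq> H" using iso(1) \<phi>' by blast
    show "H \<subseteq> ?T ` H" using TT inv_H by (metis image_eqI subsetI)
  qed
  then show ?thesis
    unfolding unitary_on_def using iso(2) \<phi>'
    by (auto simp: weighted_comp_def on_set_def fun_eq_iff algebra_simps)
qed

end

section \<open>The space \<open>\<complex>\<^sup>d\<close>\<close>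

lemma cspace_summable: "z \<in> cspace d \<Longrightarrow> summable (\<lambda>i. (cmod (z i))\<^sup>2)"
  by (simp add: cspace_def)

lemma cspace_zero_above: "z \<in> cspace d \<Longrightarrow> \<forall>i. d \<le> enat i \<longrightarrow> z i = 0"
  by (simp add: cspace_def)

lemma cspace_summable_prod:
  assumes "z \<in> cspace d" "w \<in> cspace d"
  shows "summable (\<lambda>i. z i * cnj (w i))"
proof (rule summable_comparison_test')
  show "summable (\<lambda>i. (cmod (z i))\<^sup>2 + (cmod (w i))\<^sup>2)"
    by (intro summable_add cspace_summable [OF assms(1)] cspace_summable [OF assms(2)])
  fix i
  have "2 * (cmod (z i) * cmod (w i)) \<le> (cmod (z i))\<^sup>2 + (cmod (w i))\<^sup>2"
    using sum_squares_bound [of "cmod (z i)" "cmod (w i)"] by (simp add: mult.assoc)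
  moreover have "0 \<le> cmod (z i) * cmod (w i)" by simp
  ultimately have "cmod (z i) * cmod (w i) \<le> (cmod (z i))\<^sup>2 + (cmod (w i))\<^sup>2" by linarith
  then show "norm (z i * cnj (w i)) \<le> (cmod (z i))\<^sup>2 + (cmod (w i))\<^sup>2"
    by (simp add: norm_mult)
qed

lemma cspace_add:
  assumes "z \<in> cspace d" "w \<in> cspace d"
  shows "(\<lambda>i. z i + w i) \<in> cspace d"
proof -
  have "summable (\<lambda>i. (cmod (z i + w i))\<^sup>2)"
  proof (rule summable_comparison_test')
    show "summable (\<lambda>i. 2 * (cmod (z i))\<^sup>2 + 2 * (cmod (w i))\<^sup>2)"
      by (intro summable_add summable_mult cspace_summable [OF assms(1)] cspace_summable [OF assms(2)])
    fix i
    have "(cmod (z i + w i))\<^sup>2 \<le> (cmod (z i) + cmod (w i))\<^sup>2"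
      by (intro power_mono norm_triangle_ineq) simp
    also have "\<dots> \<le> 2 * (cmod (z i))\<^sup>2 + 2 * (cmod (w i))\<^sup>2"
      using sum_squares_bound [of "cmod (z i)" "cmod (w i)"] by (simp add: power2_sum)
    finally show "norm ((cmod (z i + w i))\<^sup>2) \<le> 2 * (cmod (z i))\<^sup>2 + 2 * (cmod (w i))\<^sup>2"
      by simp
  qed
  then show ?thesis using assms by (simp add: cspace_def)
qed

lemma cinner_self: "z \<in> cspace d \<Longrightarrow> cinner z z = of_real (\<Sum>i. (cmod (z i))\<^sup>2)"
  unfolding cinner_def complex_norm_square [symmetric]
  by (rule suminf_of_real [symmetric]) (rule cspace_summable)

lemma ip_space_cspace: "ip_space (cspace d) cinner"
proof
  show "(\<lambda>x. 0) \<in> cspace d" by (simp add: cspace_def)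
  fix f g h :: "nat \<Rightarrow> complex" and c :: complex
  assume f: "f \<in> cspace d"
  show "(\<lambda>x. c * f x) \<in> cspace d"
    using f by (simp add: cspace_def norm_mult power_mult_distrib summable_mult)
  show "Re (cinner f f) > 0" if "f \<noteq> (\<lambda>x. 0)"
  proof -
    from that obtain i where "f i \<noteq> 0" by auto
    then have "(\<Sum>i. (cmod (f i))\<^sup>2) > 0"
      by (intro suminf_pos2 [OF cspace_summable [OF f], of i]) auto
    then show ?thesis by (simp add: cinner_self [OF f])
  qed
  assume g: "g \<in> cspace d"
  show "(\<lambda>x. f x + g x) \<in> cspace d" by (rule cspace_add [OF f g])
  show "cinner g f = cnj (cinner f g)"
  proof -
    have "(\<lambda>i. cnj (f i * cnj (g i))) sums cnj (cinner f g)"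
      unfolding sums_cnj cinner_def by (intro summable_sums cspace_summable_prod [OF f g])
    then have "(\<lambda>i. g i * cnj (f i)) sums cnj (cinner f g)"
      by (simp add: mult.commute)
    then show ?thesis
      unfolding cinner_def [of g f] by (rule sums_unique [symmetric])
  qed
  show "cinner (\<lambda>x. f x + g x) h = cinner f h + cinner g h" if "h \<in> cspace d"
    unfolding cinner_def distrib_right
    by (intro suminf_add [symmetric] cspace_summable_prod [OF f that] cspace_summable_prod [OF g that])
next
  fix f h :: "nat \<Rightarrow> complex" and c :: complex
  assume fh: "f \<in> cspace d" "h \<in> cspace d"
  show "cinner (\<lambda>x. c * f x) h = c * cinner f h"
    unfolding cinner_def mult.assoc by (rule suminf_mult [OF cspace_summable_prod [OF fh]])
qed

locale cball = fixes d :: enat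

sublocale cball \<subseteq> cs: ip_space "cspace d" cinner
  by (rule ip_space_cspace)

context cball
begin

lemma unit_ball_eq: "unit_ball d = cs.B"
  unfolding unit_ball_def cs.B_def ..

section \<open>Truncation of sequences and adjoints of isometries of the ball\<close>

definition trunc :: "nat \<Rightarrow> (nat \<Rightarrow> complex) \<Rightarrow> nat \<Rightarrow> complex" where
  "trunc n z = (\<lambda>i. if i < n then z i else 0)"

lemma trunc_cspace:
  assumes "\<forall>i. d \<le> enat i \<longrightarrow> z i = 0" shows "trunc n z \<in> cspace d"
proof -
  have "summable (\<lambda>i. (cmod (trunc n z i))\<^sup>2)"
    by (rule summable_finite [of "{..<n}"]) (auto simp: trunc_def)
  then show ?thesis using assms by (auto simp: cspace_def trunc_def)
qed

lemma cinner_trunc: "cinner (trunc n z) w = (\<Sum>i<n. z i * cnj (w i))"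
  unfolding cinner_def by (subst suminf_finite [of "{..<n}"]) (auto simp: trunc_def)

lemma trunc_norm_sq:
  assumes "\<forall>i. d \<le> enat i \<longrightarrow> z i = 0"
  shows "(ip_norm cinner (trunc n z))\<^sup>2 = (\<Sum>i<n. (cmod (z i))\<^sup>2)"
proof -
  have "cinner (trunc n z) (trunc n z) = (\<Sum>i<n. of_real ((cmod (z i))\<^sup>2))"
    unfolding cinner_trunc complex_norm_square by (intro sum.cong) (auto simp: trunc_def)
  then show ?thesis
    unfolding cs.N_square [OF trunc_cspace [OF assms]] by simp
qed

lemma cs_norm_sq: "z \<in> cspace d \<Longrightarrow> (ip_norm cinner z)\<^sup>2 = (\<Sum>i. (cmod (z i))\<^sup>2)"
  using cs.N_square [of z] cinner_self [of z d] by simp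

lemma trunc_B:
  assumes "z \<in> cs.B" shows "trunc n z \<in> cs.B"
proof (rule cs.BI)
  note zero = cspace_zero_above [OF cs.B_V [OF assms]]
  show V: "trunc n z \<in> cspace d" by (rule trunc_cspace [OF zero])
  have "(ip_norm cinner (trunc n z))\<^sup>2 \<le> (ip_norm cinner z)\<^sup>2"
    unfolding trunc_norm_sq [OF zero] cs_norm_sq [OF cs.B_V [OF assms]]
    by (intro sum_le_suminf cspace_summable [OF cs.B_V [OF assms]]) auto
  then have "ip_norm cinner (trunc n z) \<le> ip_norm cinner z"
    by (rule power2_le_imp_le) (rule cs.N_ge_0 [OF cs.B_V [OF assms]])
  then show "ip_norm cinner (trunc n z) < 1"
    using cs.B_N [OF assms] by linarith
qed

lemma trunc_tendsto:
  assumes z: "z \<in> cspace d"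
  shows "(\<lambda>n. ip_norm cinner (\<lambda>i. trunc n z i - z i)) \<longlonglongrightarrow> 0"
proof -
  note zero = cspace_zero_above [OF z]
  have V: "trunc n z \<in> cspace d" for n by (rule trunc_cspace [OF zero])
  have "(ip_norm cinner (\<lambda>i. trunc n z i - z i))\<^sup>2 = (ip_norm cinner z)\<^sup>2 - (\<Sum>i<n. (cmod (z i))\<^sup>2)" for n
  proof -
    have "cinner (trunc n z) z = of_real (\<Sum>i<n. (cmod (z i))\<^sup>2)"
      by (simp only: cinner_trunc complex_norm_square [symmetric] of_real_sum)
    then have "Re (cinner (trunc n z) z) = (\<Sum>i<n. (cmod (z i))\<^sup>2)"
      by (simp only: Re_complex_of_real)
    then show ?thesis
      unfolding cs.N_sq_diff [OF V z] trunc_norm_sq [OF zero] by simp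
  qed
  moreover have "(\<lambda>n. (ip_norm cinner z)\<^sup>2 - (\<Sum>i<n. (cmod (z i))\<^sup>2)) \<longlonglongrightarrow> (ip_norm cinner z)\<^sup>2 - (ip_norm cinner z)\<^sup>2"
    unfolding cs_norm_sq [OF z] by (intro tendsto_diff tendsto_const summable_LIMSEQ cspace_summable [OF z])
  ultimately have "(\<lambda>n. (ip_norm cinner (\<lambda>i. trunc n z i - z i))\<^sup>2) \<longlonglongrightarrow> 0"
    by simp
  then have "(\<lambda>n. sqrt ((ip_norm cinner (\<lambda>i. trunc n z i - z i))\<^sup>2)) \<longlonglongrightarrow> sqrt 0"
    by (rule tendsto_real_sqrt)
  then show ?thesis
    using cs.N_ge_0 [OF cs.diff_V [OF V z]] by simp
qed

text \<open>The adjoint is written down in coordinates; Bessel's inequality puts it into the ball.\<close>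

lemma ip_isometry_adjoint:
  assumes f: "f \<in> cs.B \<rightarrow> cs.B"
    and iso: "\<And>z w. z \<in> cs.B \<Longrightarrow> w \<in> cs.B \<Longrightarrow> cinner (f z) (f w) = cinner z w"
    and y: "y \<in> cs.B"
  obtains w where "w \<in> cs.B" "\<And>z. z \<in> cs.B \<Longrightarrow> cinner (f z) y = cinner z w"
proof -
  note yV = cs.B_V [OF y]
  have fB: "f z \<in> cs.B" if "z \<in> cs.B" for z using f that by blast
  have fV: "f z \<in> cspace d" if "z \<in> cs.B" for z using cs.B_V [OF fB [OF that]] .
  \<comment> \<open>\<open>h n\<close> is half of the n-th unit vector, because the unit vector
    itself is outside the open ball. The factor 2 in \<open>w\<close> compensates, so
    \<open>w n\<close> is the n-th coordinate of the adjoint applied to \<open>y\<close>.\<close>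
  define h where "h n = trunc (Suc n) (\<lambda>j. if j = n then 1/2 else 0)" for n
  define w where "w n = (if d \<le> enat n then 0 else 2 * cinner y (f (h n)))" for n
  have w0: "\<forall>n. d \<le> enat n \<longrightarrow> w n = 0" by (simp add: w_def)
  have hB: "h n \<in> cs.B" if "\<not> d \<le> enat n" for n
  proof (rule cs.BI)
    have zero: "\<forall>j. d \<le> enat j \<longrightarrow> (if j = n then 1/2 else 0) = (0::complex)"
      using that by auto
    show "h n \<in> cspace d" unfolding h_def by (rule trunc_cspace [OF zero])
    have "(\<Sum>i<Suc n. (cmod (if i = n then 1/2 else 0))\<^sup>2) = 1/4"
      by (simp add: power2_eq_square)
    then have "(ip_norm cinner (h n))\<^sup>2 = 1/4"
      unfolding h_def by (subst trunc_norm_sq [OF zero]) simp_all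
    then have "(ip_norm cinner (h n))\<^sup>2 < 1\<^sup>2" by simp
    then show "ip_norm cinner (h n) < 1" by (rule power2_less_imp_less) simp
  qed
  have part: "cinner (f (trunc n z)) y = (\<Sum>i<n. z i * cnj (w i))" if z: "z \<in> cs.B" for n z
  proof (induction n)
    case 0
    have "f (\<lambda>i. 0) = (\<lambda>i. 0)"
      using iso [OF cs.zero_B cs.zero_B] cs.ip_self [OF fV [OF cs.zero_B]] cs.N_eq_0 [OF fV [OF cs.zero_B]]
      by simp
    then show ?case using yV by (simp add: trunc_def)
  next
    case (Suc n)
    show ?case
    proof (cases "d \<le> enat n")
      case True
      then have "z n = 0" using cspace_zero_above [OF cs.B_V [OF z]] by simp
      then have "trunc (Suc n) z = trunc n z" by (auto simp: trunc_def less_Suc_eq)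
      then show ?thesis using Suc \<open>z n = 0\<close> by simp
    next
      case False
      note hn = hB [OF False]
      have eq: "trunc (Suc n) z = (\<lambda>i. trunc n z i + (2 * z n) * h n i)"
        by (auto simp: trunc_def h_def fun_eq_iff less_Suc_eq)
      have "f (trunc (Suc n) z) = (\<lambda>i. f (trunc n z) i + (2 * z n) * f (h n) i)"
        unfolding eq by (rule cs.ip_isometry_linear [OF f iso trunc_B [OF z] hn])
          (use trunc_B [OF z, of "Suc n"] in \<open>simp_all add: eq\<close>)
      then have "cinner (f (trunc (Suc n) z)) y = cinner (f (trunc n z)) y + 2 * z n * cinner (f (h n)) y"
        using cs.add_left [OF fV [OF trunc_B [OF z]] cs.scale_V [OF fV [OF hn]] yV]
          cs.scale_left [OF fV [OF hn] yV] by simp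
      moreover have "cnj (w n) = 2 * cinner (f (h n)) y"
        using False cs.commute [OF yV fV [OF hn]] by (simp add: w_def)
      ultimately show ?thesis using Suc by simp
    qed
  qed
  \<comment> \<open>\<open>part\<close> is tested on the truncation of \<open>w\<close> itself,
    scaled by \<open>1/R\<close> into the ball. Cauchy-Schwarz then bounds \<open>S\<close> by the
    norm of \<open>?v\<close> times that of \<open>y\<close>, and \<open>S\<close> is the square of
    the former.\<close>
  have bessel: "(\<Sum>i<n. (cmod (w i))\<^sup>2) \<le> (ip_norm cinner y)\<^sup>2" for n
  proof -
    define S where "S = (\<Sum>i<n. (cmod (w i))\<^sup>2)"
    let ?v = "trunc n w"
    have vV: "?v \<in> cspace d" by (rule trunc_cspace [OF w0])
    have S: "(ip_norm cinner ?v)\<^sup>2 = S" unfolding S_def by (rule trunc_norm_sq [OF w0])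
    obtain R :: real where R: "R > 0" and zB: "(\<lambda>i. of_real (1/R) * ?v i) \<in> cs.B" (is "?z \<in> _")
      by (rule cs.scale_to_B [OF vV]) (rule that)
    have "trunc n ?z = ?z" by (auto simp: trunc_def)
    then have "cinner (f ?z) y = (\<Sum>i<n. ?z i * cnj (w i))"
      using part [OF zB, of n] by simp
    also have "\<dots> = (\<Sum>i<n. of_real (1/R) * of_real ((cmod (w i))\<^sup>2))"
      unfolding complex_norm_square by (intro sum.cong) (auto simp: trunc_def)
    also have "\<dots> = of_real (S / R)"
      by (simp add: S_def sum_divide_distrib)
    finally have eq: "cinner (f ?z) y = of_real (S / R)" .
    have "S \<ge> 0" by (simp add: S_def sum_nonneg)
    then have "cmod (cinner (f ?z) y) = S / R"
      unfolding eq norm_of_real using R by simp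
    moreover have "ip_norm cinner (f ?z) = ip_norm cinner ?z"
      unfolding ip_norm_def iso [OF zB zB] ..
    moreover have "ip_norm cinner ?z = ip_norm cinner ?v / R"
      unfolding cs.N_scale [OF vV] using R by (simp add: norm_divide)
    ultimately have "S / R \<le> ip_norm cinner ?v / R * ip_norm cinner y"
      using cs.Cauchy_Schwarz [OF fV [OF zB] yV] by simp
    then have le: "S \<le> ip_norm cinner ?v * ip_norm cinner y"
      using R by (simp add: field_simps)
    have "S \<le> (ip_norm cinner y)\<^sup>2"
    proof (cases "ip_norm cinner ?v = 0")
      case True
      then show ?thesis using S by simp
    next
      case False
      then have pos: "ip_norm cinner ?v > 0" using cs.N_ge_0 [OF vV] by linarith
      have "ip_norm cinner ?v * ip_norm cinner ?v \<le> ip_norm cinner ?v * ip_norm cinner y"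
        using le S by (simp add: power2_eq_square)
      then have "ip_norm cinner ?v \<le> ip_norm cinner y" using pos by simp
      then show ?thesis unfolding S [symmetric] using pos by (intro power_mono) auto
    qed
    then show ?thesis by (simp add: S_def)
  qed
  have sw: "summable (\<lambda>i. (cmod (w i))\<^sup>2)"
    by (rule summableI_nonneg_bounded [OF _ bessel]) simp
  have wV: "w \<in> cspace d" using sw w0 by (simp add: cspace_def)
  have "(ip_norm cinner w)\<^sup>2 \<le> (ip_norm cinner y)\<^sup>2"
    unfolding cs_norm_sq [OF wV] by (rule suminf_le_const [OF sw bessel])
  then have "ip_norm cinner w \<le> ip_norm cinner y"
    by (rule power2_le_imp_le) (rule cs.N_ge_0 [OF yV])
  then have wB: "w \<in> cs.B"
    using cs.B_N [OF y] by (intro cs.BI [OF wV]) linarith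
  moreover have "cinner (f z) y = cinner z w" if z: "z \<in> cs.B" for z
  proof -
    \<comment> \<open>Continuity of \<open>f\<close> is not assumed; preserving inner products makes
      \<open>f\<close> preserve distances, which allows the passage from truncations to
      \<open>z\<close>.\<close>
    have "ip_norm cinner (\<lambda>i. f (trunc n z) i - f z i) = ip_norm cinner (\<lambda>i. trunc n z i - z i)" for n
    proof -
      note t = trunc_B [OF z, of n]
      have nf: "ip_norm cinner (f x) = ip_norm cinner x" if "x \<in> cs.B" for x
        unfolding ip_norm_def iso [OF that that] ..
      have "(ip_norm cinner (\<lambda>i. f (trunc n z) i - f z i))\<^sup>2 = (ip_norm cinner (\<lambda>i. trunc n z i - z i))\<^sup>2"
        unfolding cs.N_sq_diff [OF fV [OF t] fV [OF z]] cs.N_sq_diff [OF cs.B_V [OF t] cs.B_V [OF z]]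
          nf [OF t] nf [OF z] iso [OF t z] ..
      then show ?thesis
        using cs.N_ge_0 [OF cs.diff_V [OF fV [OF t] fV [OF z]]]
          cs.N_ge_0 [OF cs.diff_V [OF cs.B_V [OF t] cs.B_V [OF z]]] by simp
    qed
    then have "(\<lambda>n. ip_norm cinner (\<lambda>i. f (trunc n z) i - f z i)) \<longlonglongrightarrow> 0"
      using trunc_tendsto [OF cs.B_V [OF z]] by simp
    then have "(\<lambda>n. cinner (f (trunc n z)) y) \<longlonglongrightarrow> cinner (f z) y"
      by (rule cs.tendsto_ip_left [OF fV [OF trunc_B [OF z]] fV [OF z] yV])
    moreover have "(\<lambda>n. cinner (f (trunc n z)) y) \<longlonglongrightarrow> cinner z w"
      unfolding part [OF z] cinner_def [of z w]
      by (rule summable_LIMSEQ [OF cspace_summable_prod [OF cs.B_V [OF z] wV]])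
    ultimately show ?thesis by (rule LIMSEQ_unique)
  qed
  ultimately show ?thesis by (rule that)
qed

end

section \<open>Unitary weighted composition operators\<close>

context ip_space
begin

text \<open>The kernel is 1 when one argument is the origin. Consequently \<delta> never vanishes
  and is tied to the kernel at \<open>\<phi> (\<lambda>i. 0)\<close>.\<close>

lemma kernel_identity_0:
  assumes \<phi>: "\<phi> \<in> B \<rightarrow> B"
    and id: "\<And>z w. z \<in> B \<Longrightarrow> w \<in> B \<Longrightarrow> kern \<gamma> z w = \<delta> z * cnj (\<delta> w) * kern \<gamma> (\<phi> z) (\<phi> w)"
    and z: "z \<in> B"
  shows "\<delta> z * cnj (\<delta> (\<lambda>i. 0)) * kern \<gamma> (\<phi> z) (\<phi> (\<lambda>i. 0)) = 1"
    and "\<delta> (\<lambda>i. 0) * cnj (\<delta> z) * kern \<gamma> (\<phi> (\<lambda>i. 0)) (\<phi> z) = 1"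
  using id [OF z zero_B] id [OF zero_B z] z by simp_all

lemma kernel_identity_imp_isometry:
  assumes \<gamma>: "\<gamma> > 0" and \<phi>: "\<phi> \<in> B \<rightarrow> B"
    and id: "\<And>z w. z \<in> B \<Longrightarrow> w \<in> B \<Longrightarrow> kern \<gamma> z w = \<delta> z * cnj (\<delta> w) * kern \<gamma> (\<phi> z) (\<phi> w)"
    and z: "z \<in> B" and w: "w \<in> B"
  defines "b \<equiv> \<phi> (\<lambda>i. 0)"
  shows "ip (moebius b (\<phi> z)) (moebius b (\<phi> w)) = ip z w"
proof (rule kern_isometry_imp_ip_isometry [OF \<gamma> _ _ z w])
  have \<phi>B: "\<phi> x \<in> B" if "x \<in> B" for x using \<phi> that by blast
  have b: "b \<in> B" unfolding b_def by (rule \<phi>B [OF zero_B])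
  show "(\<lambda>x. moebius b (\<phi> x)) \<in> B \<rightarrow> B"
    by (intro funcsetI moebius_B b \<phi>B)
  fix x y assume x: "x \<in> B" and y: "y \<in> B"
  have e: "\<delta> u * cnj (\<delta> (\<lambda>i. 0)) * kern \<gamma> (\<phi> u) b = 1"
    "\<delta> (\<lambda>i. 0) * cnj (\<delta> u) * kern \<gamma> b (\<phi> u) = 1" if "u \<in> B" for u
    unfolding b_def by (rule kernel_identity_0 [OF \<phi> id that]; assumption)+
  \<comment> \<open>\<open>D\<close>, \<open>D0\<close> are the weights at \<open>x\<close> and 0,
    \<open>E\<close>, \<open>C\<close> the conjugated weights at \<open>y\<close> and 0.
    \<open>P\<close>, \<open>Q\<close>, \<open>B0\<close> are the kernel values involving
    \<open>b\<close>, and \<open>K\<close>, \<open>X\<close> those at the images and at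
    \<open>x\<close>, \<open>y\<close>.\<close>
  have *: "B0 * K / (P * Q) = X"
    if "D * C * P = 1" "D0 * E * Q = 1" "D0 * C * B0 = 1" "X = D * E * K"
    for B0 K P Q X D C D0 E :: complex
  proof -
    have nz: "P \<noteq> 0" "Q \<noteq> 0" using that by auto
    have "B0 * K = B0 * K * (D * C * P) * (D0 * E * Q)" using that by simp
    also have "\<dots> = (D0 * C * B0) * (D * E * K) * (P * Q)" by (simp only: mult_ac)
    finally have "B0 * K = X * (P * Q)" using that by simp
    then show ?thesis using nz by simp
  qed
  show "kern \<gamma> (moebius b (\<phi> x)) (moebius b (\<phi> y)) = kern \<gamma> x y"
    unfolding kern_moebius [OF b \<phi>B [OF x] \<phi>B [OF y]]
    by (rule * [OF e(1) [OF x] e(2) [OF y] e(1) [OF zero_B, unfolded b_def [symmetric]] id [OF x y]])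
qed

text \<open>Since \<open>\<phi> a\<close> is the origin, the kernel identity with second point
  \<open>a\<close> reads \<open>kern \<gamma> z a = \<delta> z * cnj (\<delta> a)\<close>. At
  \<open>z = a\<close> it gives the modulus of \<open>\<delta> a\<close>, so \<mu> is the phase of
  \<open>\<delta> a\<close>.\<close>

lemma kernel_identity_weight:
  assumes id: "\<And>z w. z \<in> B \<Longrightarrow> w \<in> B \<Longrightarrow> kern \<gamma> z w = \<delta> z * cnj (\<delta> w) * kern \<gamma> (\<phi> z) (\<phi> w)"
    and \<phi>: "\<phi> \<in> B \<rightarrow> B" and a: "a \<in> B" "\<phi> a = (\<lambda>i. 0)"
  shows "\<exists>\<mu>. cmod \<mu> = 1 \<and> (\<forall>z\<in>B. \<delta> z = \<mu> * (kern \<gamma> z a / csqrt (kern \<gamma> a a)))"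
proof -
  define k where "k = (1 - (N a)\<^sup>2) powr (- \<gamma>)"
  have k: "kern \<gamma> a a = of_real k" "k > 0" unfolding k_def by (rule kern_diag [OF a(1)])+
  have e: "kern \<gamma> z a = \<delta> z * cnj (\<delta> a)" if z: "z \<in> B" for z
  proof -
    have "\<phi> z \<in> V" using \<phi> z by (intro B_V) blast
    then show ?thesis using id [OF z a(1)] unfolding a(2) by simp
  qed
  have "complex_of_real k = of_real ((cmod (\<delta> a))\<^sup>2)"
    unfolding k(1) [symmetric] e [OF a(1)] by (rule complex_norm_square [symmetric])
  then have d: "k = (cmod (\<delta> a))\<^sup>2" unfolding of_real_eq_iff .
  then have nz: "\<delta> a \<noteq> 0" and sq: "sqrt k = cmod (\<delta> a)" using k(2) by auto
  have cs: "csqrt (kern \<gamma> a a) = of_real (cmod (\<delta> a))"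
    unfolding k(1) sq [symmetric] using k(2) by (intro of_real_sqrt [symmetric]) simp
  show ?thesis
  proof (intro exI [of _ "of_real (cmod (\<delta> a)) / cnj (\<delta> a)"] conjI ballI)
    show "cmod (of_real (cmod (\<delta> a)) / cnj (\<delta> a)) = 1" using nz by (simp add: norm_divide)
    show "\<delta> z = of_real (cmod (\<delta> a)) / cnj (\<delta> a) * (kern \<gamma> z a / csqrt (kern \<gamma> a a))" if "z \<in> B" for z
      unfolding e [OF that] cs using nz by simp
  qed
qed

text \<open>In the product \<mu> meets its conjugate and the two real square roots recombine. What
  remains is the reciprocal of the factor by which an automorphism changes the kernel.\<close>

lemma weight_product:
  assumes \<mu>: "cmod \<mu> = 1" and \<delta>: "\<And>z. z \<in> B \<Longrightarrow> \<delta> z = \<mu> * (kern \<gamma> z a / csqrt (kern \<gamma> a a))"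
    and a: "a \<in> B" and z: "z \<in> B" and w: "w \<in> B"
  shows "\<delta> z \<noteq> 0" and "\<delta> z * cnj (\<delta> w) = kern \<gamma> z a * kern \<gamma> a w / kern \<gamma> a a"
proof -
  define k where "k = (1 - (N a)\<^sup>2) powr (- \<gamma>)"
  have k: "kern \<gamma> a a = of_real k" "k > 0" unfolding k_def by (rule kern_diag [OF a])+
  have cs: "csqrt (kern \<gamma> a a) = of_real (sqrt k)"
    unfolding k(1) using k(2) by (intro of_real_sqrt [symmetric]) simp
  have "\<mu> \<noteq> 0" using \<mu> by auto
  then show "\<delta> z \<noteq> 0" unfolding \<delta> [OF z] cs using k(2) kern_nz [OF z a] by simp
  have \<mu>\<mu>: "\<mu> * cnj \<mu> = 1" unfolding complex_norm_square [symmetric] \<mu> by simp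
  have ss: "complex_of_real (sqrt k) * of_real (sqrt k) = of_real k"
    unfolding of_real_mult [symmetric] using k(2) by simp
  have "\<delta> z * cnj (\<delta> w) = (\<mu> * cnj \<mu>) * (kern \<gamma> z a * cnj (kern \<gamma> w a)) / (of_real (sqrt k) * of_real (sqrt k))"
    unfolding \<delta> [OF z] \<delta> [OF w] cs by simp
  then show "\<delta> z * cnj (\<delta> w) = kern \<gamma> z a * kern \<gamma> a w / kern \<gamma> a a"
    unfolding \<mu>\<mu> ss k(1) kern_cnj [OF w a] by simp
qed

end

context cball
begin

lemma holomorphic_mapI:
  assumes "cs.line_analytic f" "f \<in> cs.B \<rightarrow> cs.B"
  shows "holomorphic_map (cspace d) cinner (cspace d) cinner cs.B f"
  unfolding holomorphic_map_def
proof (intro conjI ballI)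
  show "f \<in> cs.B \<rightarrow> cspace d" using assms(2) cs.B_V by blast
  show "\<exists>r>0. \<exists>M. \<forall>w\<in>cs.B. cs.N (\<lambda>i. w i - z i) < r \<longrightarrow> cs.N (f w) \<le> M" for z
  proof (intro exI [of _ 1] conjI ballI impI)
    fix w assume "w \<in> cs.B"
    then show "cs.N (f w) \<le> 1" using cs.B_N [OF funcset_mem [OF assms(2)]] by (intro less_imp_le)
  qed simp
  show "(\<lambda>t. cinner (f (\<lambda>i. z i + t * \<xi> i)) \<eta>) analytic_on {0}"
    if "z \<in> cs.B" "\<xi> \<in> cspace d" "\<eta> \<in> cspace d" for z \<xi> \<eta>
    using assms(1) [unfolded cs.line_analytic_def, rule_format, OF that] .
qed

lemma unitary_imp_surj:
  assumes \<gamma>: "\<gamma> > 0" and rkhs: "rkhs H ip cs.B (cs.kern \<gamma>)"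
    and \<phi>: "\<phi> \<in> cs.B \<rightarrow> cs.B" and U: "unitary_on H ip (weighted_comp cs.B \<delta> \<phi>)"
    and p: "p \<in> cs.B"
  shows "p \<in> \<phi> ` cs.B"
proof -
  interpret R: rkhs H ip cs.B "cs.kern \<gamma>" by (rule rkhs)
  let ?K = "cs.kern \<gamma>" and ?T = "weighted_comp cs.B \<delta> \<phi>"
  define b where "b = \<phi> (\<lambda>i. 0)"
  have \<phi>B: "\<phi> x \<in> cs.B" if "x \<in> cs.B" for x using \<phi> that by blast
  have b: "b \<in> cs.B" unfolding b_def by (rule \<phi>B [OF cs.zero_B])
  note id = R.unitary_kernel_identity [OF \<phi> U]
  have e: "\<delta> z * cnj (\<delta> (\<lambda>i. 0)) * ?K (\<phi> z) b = 1" if "z \<in> cs.B" for z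
    unfolding b_def by (rule cs.kernel_identity_0(1) [OF \<phi> id that])
  define f where "f z = cs.moebius b (\<phi> z)" for z
  have fB: "f z \<in> cs.B" if "z \<in> cs.B" for z unfolding f_def by (intro cs.moebius_B b \<phi>B that)
  have iso: "cinner (f z) (f w) = cinner z w" if "z \<in> cs.B" "w \<in> cs.B" for z w
    unfolding f_def b_def by (rule cs.kernel_identity_imp_isometry [OF \<gamma> \<phi> id that])
  define y where "y = cs.moebius b p"
  have y: "y \<in> cs.B" unfolding y_def by (intro cs.moebius_B b p)
  have "f \<in> cs.B \<rightarrow> cs.B" using fB by blast
  then obtain w where w: "w \<in> cs.B" and adj: "\<And>z. z \<in> cs.B \<Longrightarrow> cinner (f z) y = cinner z w"
    by (rule ip_isometry_adjoint [OF _ iso y]) (assumption+, rule that)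
  define c where "c = inverse (cnj (\<delta> (\<lambda>i. 0)) * ?K b y)"
  have d0: "\<delta> z \<noteq> 0" if "z \<in> cs.B" for z using e [OF that] by auto
  \<comment> \<open>Undoing the Moebius map turns \<open>?K (\<phi> z) p\<close> into
    \<open>?K z w\<close> times factors, of which only \<open>?K (\<phi> z) b\<close> depends on
    \<open>z\<close>. The weight \<open>\<delta> z\<close> absorbs this one, leaving the constant
    \<open>c\<close>.\<close>
  have Kp: "\<delta> z * ?K (\<phi> z) p = c * ?K z w" if z: "z \<in> cs.B" for z
  proof -
    have "?K (\<phi> z) p = ?K (cs.moebius b (f z)) (cs.moebius b y)"
      unfolding f_def y_def cs.moebius_moebius [OF b \<phi>B [OF z]] cs.moebius_moebius [OF b p] ..
    also have "\<dots> = ?K b b * ?K (f z) y / (?K (f z) b * ?K b y)"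
      by (rule cs.kern_moebius [OF b fB [OF z] y])
    also have "?K (f z) y = ?K z w" unfolding adj [OF z] ..
    also have "?K (f z) b = ?K b b / ?K (\<phi> z) b"
      using cs.kern_moebius [OF b \<phi>B [OF z] cs.zero_B, of \<gamma>] \<phi>B [OF z] b
      by (simp add: f_def cs.moebius_0)
    finally have KK: "?K (\<phi> z) p = ?K z w * ?K (\<phi> z) b / ?K b y"
      using cs.kern_nz [OF b b] by simp
    have db: "\<delta> z * ?K (\<phi> z) b = inverse (cnj (\<delta> (\<lambda>i. 0)))"
      by (rule inverse_unique [symmetric]) (use e [OF z] in \<open>simp only: mult_ac\<close>)
    have alg: "x * (A * P / Y) = inverse (D * Y) * A" if "x * P = inverse D" for x A P Y D :: complex
    proof -
      have "x * (A * P / Y) = (x * P) * A / Y" by simp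
      then show ?thesis unfolding that by (simp add: divide_inverse)
    qed
    show ?thesis
      unfolding KK c_def by (rule alg [OF db])
  qed
  \<comment> \<open>The kernel identity shows that a multiple of the kernel function at
    \<open>\<phi> w\<close> has the same image as the one at \<open>p\<close>.\<close>
  have TT: "?T (R.ker p) = ?T (\<lambda>u. (c * cnj (\<delta> w)) * R.ker (\<phi> w) u)"
  proof
    fix u show "?T (R.ker p) u = ?T (\<lambda>u. (c * cnj (\<delta> w)) * R.ker (\<phi> w) u) u"
    proof (cases "u \<in> cs.B")
      case True
      then show ?thesis
        using Kp [OF True] id [OF True w] \<phi>B [OF True]
        by (simp add: weighted_comp_def on_set_def mult_ac)
    qed (simp add: weighted_comp_def on_set_def)
  qed
  note kp = R.ker_H [OF p] and kw = R.scale_V [OF R.ker_H [OF \<phi>B [OF w]], of "c * cnj (\<delta> w)"]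
  have TI: "ip (?T g) (?T h) = ip g h" if "g \<in> H" "h \<in> H" for g h
    using U that by (simp add: unitary_on_def)
  have ker_eq: "R.ker p = (\<lambda>u. (c * cnj (\<delta> w)) * R.ker (\<phi> w) u)"
  proof (rule R.eq_if_ip_eq [OF kp kw])
    fix h assume h: "h \<in> H"
    show "ip h (R.ker p) = ip h (\<lambda>u. (c * cnj (\<delta> w)) * R.ker (\<phi> w) u)"
      unfolding TI [OF h kp, symmetric] TI [OF h kw, symmetric] TT ..
  qed
  have eq: "?K u p = (c * cnj (\<delta> w)) * ?K u (\<phi> w)" if "u \<in> cs.B" for u
    using fun_cong [OF ker_eq, of u] that by (simp only: on_set_def if_True)
  \<comment> \<open>Both kernel functions take the value 1 at the origin, so proportionality is
    equality.\<close>
  have "c * cnj (\<delta> w) = 1"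
    using eq [OF cs.zero_B] cs.B_V [OF p] cs.B_V [OF \<phi>B [OF w]] by simp
  then have "p = \<phi> w"
    using eq by (intro cs.kern_inj [OF \<gamma> p \<phi>B [OF w]]) simp
  then show ?thesis using w by blast
qed

lemma unitary_imp_automorphism:
  assumes \<gamma>: "\<gamma> > 0" and rkhs: "rkhs H ip cs.B (cs.kern \<gamma>)"
    and \<phi>: "\<phi> \<in> cs.B \<rightarrow> cs.B" and U: "unitary_on H ip (weighted_comp cs.B \<delta> \<phi>)"
  shows "\<phi> \<in> ball_aut d"
proof -
  interpret R: rkhs H ip cs.B "cs.kern \<gamma>" by (rule rkhs)
  define b where "b = \<phi> (\<lambda>i. 0)"
  have \<phi>B: "\<phi> x \<in> cs.B" if "x \<in> cs.B" for x using \<phi> that by blast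
  have b: "b \<in> cs.B" unfolding b_def by (rule \<phi>B [OF cs.zero_B])
  note id = R.unitary_kernel_identity [OF \<phi> U]
  define f where "f z = cs.moebius b (\<phi> z)" for z
  have fB: "f \<in> cs.B \<rightarrow> cs.B" unfolding f_def by (intro funcsetI cs.moebius_B b \<phi>B)
  have \<phi>f: "\<phi> z = cs.moebius b (f z)" if "z \<in> cs.B" for z
    unfolding f_def cs.moebius_moebius [OF b \<phi>B [OF that]] ..
  have iso: "cinner (f z) (f w) = cinner z w" if "z \<in> cs.B" "w \<in> cs.B" for z w
    unfolding f_def b_def by (rule cs.kernel_identity_imp_isometry [OF \<gamma> \<phi> id that])
  have "inj_on \<phi> cs.B"
  proof (rule inj_onI)
    fix x y assume x: "x \<in> cs.B" and y: "y \<in> cs.B" and "\<phi> x = \<phi> y"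
    then have fxy: "f x = f y" by (simp add: f_def)
    show "x = y"
    proof (rule cs.eq_if_N_diff [OF cs.B_V [OF x] cs.B_V [OF y]])
      have "cinner y y = cinner x y" "cinner x x = cinner x y"
        using iso [OF y y] iso [OF x y] iso [OF x x] fxy by simp_all
      then show "(cs.N x)\<^sup>2 + (cs.N y)\<^sup>2 \<le> 2 * Re (cinner x y)"
        unfolding cs.N_square [OF cs.B_V [OF x]] cs.N_square [OF cs.B_V [OF y]] by simp
    qed
  qed
  moreover have "\<phi> ` cs.B = cs.B"
    using \<phi>B unitary_imp_surj [OF \<gamma> rkhs \<phi> U] by blast
  ultimately have bij: "bij_betw \<phi> cs.B cs.B" by (simp add: bij_betw_def)
  define \<psi> where "\<psi> = inv_into cs.B \<phi>"
  have \<psi>B: "\<psi> z \<in> cs.B" and \<phi>\<psi>: "\<phi> (\<psi> z) = z" if "z \<in> cs.B" for z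
    using that bij_betw_inv_into [OF bij] bij_betw_inv_into_right [OF bij]
    by (auto simp: bij_betw_def \<psi>_def)
  define g where "g z = \<psi> (cs.moebius b z)" for z
  have gB: "g \<in> cs.B \<rightarrow> cs.B" unfolding g_def by (intro funcsetI \<psi>B cs.moebius_B b)
  have fg: "f (g z) = z" if "z \<in> cs.B" for z
    unfolding f_def g_def \<phi>\<psi> [OF cs.moebius_B [OF b that]] by (rule cs.moebius_moebius [OF b that])
  \<comment> \<open>A bijection preserving inner products has its inverse as adjoint. Holomorphy
    enters here: \<open>line_analytic_adjoint\<close> is applied after the identity for
    \<open>f\<close> and after \<open>moebius b\<close> for \<open>\<psi>\<close>.\<close>
  have adj: "cinner (f x) y = cinner x (g y)" if "x \<in> cs.B" "y \<in> cs.B" for x y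
    using iso [OF that(1) funcset_mem [OF gB that(2)]] fg [OF that(2)] by simp
  have adj': "cinner (g x) y = cinner x (f y)" if "x \<in> cs.B" "y \<in> cs.B" for x y
    using iso [OF funcset_mem [OF gB that(1)] that(2)] fg [OF that(1)] by simp
  have "cs.line_analytic f"
    using cs.line_analytic_adjoint [OF cs.line_analytic_id _ fB gB adj] by simp
  then have "cs.line_analytic (\<lambda>z. cs.moebius b (f z))" by (rule cs.line_analytic_moebius [OF _ fB b])
  then have "cs.line_analytic \<phi>" by (rule cs.line_analytic_cong) (rule \<phi>f [symmetric])
  moreover have "cs.line_analytic \<psi>"
  proof (rule cs.line_analytic_cong)
    show "cs.line_analytic (\<lambda>z. g (cs.moebius b z))"
      by (rule cs.line_analytic_adjoint [OF cs.line_analytic_moebius [OF cs.line_analytic_id _ b] _ gB fB adj'])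
        (auto intro: cs.moebius_B b)
    show "g (cs.moebius b z) = \<psi> z" if "z \<in> cs.B" for z
      unfolding g_def cs.moebius_moebius [OF b that] ..
  qed
  moreover have "\<psi> \<in> cs.B \<rightarrow> cs.B" using \<psi>B by blast
  ultimately show ?thesis
    using bij \<phi> by (simp add: ball_aut_def unit_ball_eq holomorphic_mapI flip: \<psi>_def)
qed

text \<open>Precomposition is used because \<open>moebius a\<close> sends 0 to \<open>a\<close> and
  \<open>\<phi>\<close> sends \<open>a\<close> to 0. Cartan's theorem makes \<open>\<phi>\<close> an
  isometry after \<open>moebius a\<close>, so the kernel changes exactly as under
  \<open>moebius a\<close>.\<close>

lemma automorphism_kernel_identity:
  assumes \<phi>: "\<phi> \<in> ball_aut d"
  defines "a \<equiv> inv_into cs.B \<phi> (\<lambda>i. 0)"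
  shows "a \<in> cs.B" "\<phi> a = (\<lambda>i. 0)" "bij_betw \<phi> cs.B cs.B"
    and "z \<in> cs.B \<Longrightarrow> w \<in> cs.B \<Longrightarrow>
      cs.kern \<gamma> (\<phi> z) (\<phi> w) = cs.kern \<gamma> a a * cs.kern \<gamma> z w / (cs.kern \<gamma> z a * cs.kern \<gamma> a w)"
proof -
  define \<psi> where "\<psi> = inv_into cs.B \<phi>"
  show bij: "bij_betw \<phi> cs.B cs.B" using \<phi> by (simp add: ball_aut_def unit_ball_eq)
  have line_analytic: "cs.line_analytic \<phi>" "cs.line_analytic \<psi>"
    using \<phi> unfolding ball_aut_def unit_ball_eq holomorphic_map_def cs.line_analytic_def \<psi>_def by blast+
  have \<psi>B: "\<psi> z \<in> cs.B" and \<phi>\<psi>: "\<phi> (\<psi> z) = z" if "z \<in> cs.B" for z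
    using that bij_betw_inv_into [OF bij] bij_betw_inv_into_right [OF bij]
    by (auto simp: bij_betw_def \<psi>_def)
  have \<phi>B: "\<phi> z \<in> cs.B" and \<psi>\<phi>: "\<psi> (\<phi> z) = z" if "z \<in> cs.B" for z
    using that bij bij_betw_inv_into_left [OF bij] by (auto simp: bij_betw_def \<psi>_def)
  have a_def': "a = \<psi> (\<lambda>i. 0)" by (simp add: a_def \<psi>_def)
  show a: "a \<in> cs.B" and \<phi>a: "\<phi> a = (\<lambda>i. 0)"
    unfolding a_def' by (rule \<psi>B [OF cs.zero_B], rule \<phi>\<psi> [OF cs.zero_B])
  define f g where "f z = \<phi> (cs.moebius a z)" and "g z = cs.moebius a (\<psi> z)" for z
  have fB: "f \<in> cs.B \<rightarrow> cs.B" and gB: "g \<in> cs.B \<rightarrow> cs.B"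
    unfolding f_def g_def by (intro funcsetI cs.moebius_B \<phi>B \<psi>B a; assumption)+
  have "cs.moebius a a = (\<lambda>i. 0)"
    using cs.moebius_moebius [OF a cs.zero_B] cs.moebius_0 [OF cs.B_V [OF a]] by simp
  then have g0: "g (\<lambda>i. 0) = (\<lambda>i. 0)" unfolding g_def a_def' [symmetric] .
  have f0: "f (\<lambda>i. 0) = (\<lambda>i. 0)" unfolding f_def cs.moebius_0 [OF cs.B_V [OF a]] by (rule \<phi>a)
  have gf: "g (f z) = z" if "z \<in> cs.B" for z
    unfolding f_def g_def \<psi>\<phi> [OF cs.moebius_B [OF a that]] by (rule cs.moebius_moebius [OF a that])
  have wf: "cs.line_analytic f" unfolding f_def by (rule cs.line_analytic_comp_moebius [OF line_analytic(1) a])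
  have wg: "cs.line_analytic g" unfolding g_def
    by (rule cs.line_analytic_moebius [OF line_analytic(2) _ a]) (rule funcsetI, rule \<psi>B)
  have iso: "cinner (f z) (f w) = cinner z w" if "z \<in> cs.B" "w \<in> cs.B" for z w
    by (rule cs.cartan [OF wf fB f0 wg gB g0 gf that])
  show "cs.kern \<gamma> (\<phi> z) (\<phi> w) = cs.kern \<gamma> a a * cs.kern \<gamma> z w / (cs.kern \<gamma> z a * cs.kern \<gamma> a w)"
    if z: "z \<in> cs.B" and w: "w \<in> cs.B"
  proof -
    have "cinner (\<phi> z) (\<phi> w) = cinner (cs.moebius a z) (cs.moebius a w)"
      using iso [OF cs.moebius_B [OF a z] cs.moebius_B [OF a w]]
      unfolding f_def cs.moebius_moebius [OF a z] cs.moebius_moebius [OF a w] .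
    then show ?thesis using cs.kern_moebius [OF a z w, of \<gamma>] by simp
  qed
qed

end

theorem corollary4p2:
  fixes d :: enat and \<gamma> :: real
    and H :: "((nat \<Rightarrow> complex) \<Rightarrow> complex) set"
    and ip :: "((nat \<Rightarrow> complex) \<Rightarrow> complex) \<Rightarrow> ((nat \<Rightarrow> complex) \<Rightarrow> complex) \<Rightarrow> complex"
    and \<phi> :: "(nat \<Rightarrow> complex) \<Rightarrow> (nat \<Rightarrow> complex)"
    and \<delta> :: "(nat \<Rightarrow> complex) \<Rightarrow> complex"
  assumes "\<gamma> > 0"
    and "rkhs H ip (unit_ball d) (ball_kernel \<gamma>)"
    and "\<phi> \<in> unit_ball d \<rightarrow> unit_ball d"
  shows "unitary_on H ip (weighted_comp (unit_ball d) \<delta> \<phi>) \<longleftrightarrow>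
         \<phi> \<in> ball_aut d \<and>
         (let a = inv_into (unit_ball d) \<phi> (\<lambda>i. 0) in
            \<exists>\<mu>. cmod \<mu> = 1 \<and>
              (\<forall>z\<in>unit_ball d. \<delta> z = \<mu> * (ball_kernel \<gamma> z a / csqrt (ball_kernel \<gamma> a a))))"
proof -
  interpret cball d .
  have K: "ball_kernel \<gamma> = cs.kern \<gamma>" by (intro ext) (simp add: ball_kernel_def)
  define a where "a = inv_into cs.B \<phi> (\<lambda>i. 0)"
  have rkhs: "rkhs H ip cs.B (cs.kern \<gamma>)" using assms(2) unfolding unit_ball_eq K .
  have \<phi>: "\<phi> \<in> cs.B \<rightarrow> cs.B" using assms(3) unfolding unit_ball_eq .
  interpret R: rkhs H ip cs.B "cs.kern \<gamma>" by (rule rkhs)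
  have "unitary_on H ip (weighted_comp cs.B \<delta> \<phi>) \<longleftrightarrow> \<phi> \<in> ball_aut d \<and>
    (\<exists>\<mu>. cmod \<mu> = 1 \<and> (\<forall>z\<in>cs.B. \<delta> z = \<mu> * (cs.kern \<gamma> z a / csqrt (cs.kern \<gamma> a a))))"
    (is "?U \<longleftrightarrow> ?A \<and> ?W")
  proof
    assume U: ?U
    have A: ?A by (rule unitary_imp_automorphism [OF assms(1) rkhs \<phi> U])
    have ?W
      by (rule cs.kernel_identity_weight [OF R.unitary_kernel_identity [OF \<phi> U] \<phi>])
        (use automorphism_kernel_identity(1,2) [OF A] in \<open>simp_all add: a_def\<close>)
    with A show "?A \<and> ?W" ..
  next
    assume "?A \<and> ?W"
    then obtain \<mu> where A: ?A and \<mu>: "cmod \<mu> = 1"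
      and \<delta>: "\<And>z. z \<in> cs.B \<Longrightarrow> \<delta> z = \<mu> * (cs.kern \<gamma> z a / csqrt (cs.kern \<gamma> a a))" by blast
    note auto_id = automorphism_kernel_identity [OF A, folded a_def]
    note wp = cs.weight_product [OF \<mu> \<delta> auto_id(1)]
    show ?U
    proof (rule R.weighted_comp_unitary [OF auto_id(3)])
      show "\<delta> z \<noteq> 0" if "z \<in> cs.B" for z by (rule wp(1) [OF _ that that])
      show "cs.kern \<gamma> z w = \<delta> z * cnj (\<delta> w) * cs.kern \<gamma> (\<phi> z) (\<phi> w)"
        if "z \<in> cs.B" "w \<in> cs.B" for z w
        using wp(2) [OF _ that] auto_id(4) [OF that] cs.kern_nz [OF that(1) auto_id(1)]
          cs.kern_nz [OF auto_id(1) that(2)] cs.kern_nz [OF auto_id(1,1)]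
        by simp
    qed
  qed
  then show ?thesis
    unfolding Let_def unit_ball_eq K a_def .
qed

end
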